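(* Let $X=(X_1,X_2,\dots)$ be a sequence of random variables, defined on a probability space $(\mathbb X,\mathcal F,\mathbb P)$, taking values in a countable set $\Omega$, and let $\Delta$ be its matrix of $\eta$-mixing coefficients, with $\|\Delta\|<\infty$. Let $\varphi:\Omega^{\mathbb N}\to\mathbb R$ be a measurable $c$-Lipschitz function for some $c=(c_i)_{i\ge1}\in\ell^2$ such that $\varphi(X)\in L^1$. Then for any $t>0$, $$\mathbb P\big(|\varphi(X)-\mathbb E[\varphi(X)]|\ge t\big)\le 2\exp\left(\frac{-t^2}{2\|\Delta\|^2\|c\|^2}\right).$$
   Context: $\mathbb N=\{1,2,\dots\}$. $\ell^2$ is the space of real sequences $v=(v_j)_{j\in\mathbb N}$ with $\|v\|^2=\sum_{j\ge1}v_j^2<\infty$. Mixing coefficients: write $X^{\ge j}=(X_j,X_{j+1},\dots)$ and $X^{\le i}=(X_1,\dots,X_i)$. For $j\ge i$, $$\eta_{ij}=\sup_{x,x'}\ \sup_{A}\ \big|\mathbb P(X^{\ge j}\in A\mid X^{\le i}=x)-\mathbb P(X^{\ge j}\in A\mid X^{\le i}=x')\big|,$$ where the first supremum is over $x,x'\in\Omega^i$ that differ only in the $i$-th coordinate, the second over all measurable sets $A$ of sequences, and a pair $x,x'$ with $\mathbb P(X^{\le i}=x)=0$ or $\mathbb P(X^{\le i}=x')=0$ contributes $0$. The infinite matrix $\Delta$ is $\Delta_{ij}=\eta_{ij}$ if $j>i$, $\Delta_{ii}=1$, $\Delta_{ij}=0$ if $j<i$; $\|\Delta\|=\sup_{\|v\|=1}\|\Delta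 v\|$ is its operator norm on $\ell^2$. $c$-Lipschitz: for $c=(c_i)_{i\ge1}$ real, $\varphi:\Omega^{\mathbb N}\to\mathbb R$ is $c$-Lipschitz if for every $i$ and all $x,x'\in\Omega^{\mathbb N}$ which differ only in coordinate $i$, $|\varphi(x)-\varphi(x')|\le c_i$. *)

theory Defs
  imports "HOL-Probability.Probability"
begin

(* Sequences are indexed by nat, so the index i here is the mathematical index i + 1.
   A countable set of states S carries the discrete sigma-algebra. *)

abbreviation seq_space :: "'b set \<Rightarrow> (nat \<Rightarrow> 'b) measure" where
  "seq_space S \<equiv> PiM UNIV (\<lambda>_. count_space S)"

definition differ_only_at :: "nat \<Rightarrow> (nat \<Rightarrow> 'b) \<Rightarrow> (nat \<Rightarrow> 'b) \<Rightarrow> bool" where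
  "differ_only_at i x x' \<longleftrightarrow> x i \<noteq> x' i \<and> (\<forall>k. k \<noteq> i \<longrightarrow> x k = x' k)"

definition ell2 :: "(nat \<Rightarrow> real) set" where
  "ell2 = {v. summable (\<lambda>j. (v j)\<^sup>2)}"

definition ell2_norm :: "(nat \<Rightarrow> real) \<Rightarrow> real" where
  "ell2_norm v = sqrt (\<Sum>j. (v j)\<^sup>2)"

definition matrix_apply :: "(nat \<Rightarrow> nat \<Rightarrow> real) \<Rightarrow> (nat \<Rightarrow> real) \<Rightarrow> nat \<Rightarrow> real" where
  "matrix_apply D v i = (\<Sum>j. D i j * v j)"

(* The norm is infinite if some D v has a divergent entry or does not lie in ell2. *)
definition matrix_norm :: "(nat \<Rightarrow> nat \<Rightarrow> real) \<Rightarrow> ereal" where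
  "matrix_norm D =
     (SUP v \<in> {v \<in> ell2. ell2_norm v = 1}.
        if (\<forall>i. summable (\<lambda>j. D i j * v j)) \<and> matrix_apply D v \<in> ell2
        then ereal (ell2_norm (matrix_apply D v)) else \<infinity>)"

(* The points x, x' of the finite power with coordinates 0, ..., i are extensional functions.
   The element 0 is the contribution of the pairs in which one of the conditioning events is
   null; it also makes the supremum 0 if there are no pairs at all. *)
definition eta ::
  "'a measure \<Rightarrow> 'b set \<Rightarrow> (nat \<Rightarrow> 'a \<Rightarrow> 'b) \<Rightarrow> nat \<Rightarrow> nat \<Rightarrow> real" where
  "eta M S X i j = Sup (insert 0
     {\<bar>\<P>(\<omega> in M. (\<lambda>k. X (j + k) \<omega>) \<in> A \<bar> \<forall>k\<le>i. X k \<omega> = x k)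
       - \<P>(\<omega> in M. (\<lambda>k. X (j + k) \<omega>) \<in> A \<bar> \<forall>k\<le>i. X k \<omega> = x' k)\<bar> | x x' A.
      x \<in> {..i} \<rightarrow>\<^sub>E S \<and> x' \<in> {..i} \<rightarrow>\<^sub>E S \<and> differ_only_at i x x' \<and>
      A \<in> sets (seq_space S) \<and>
      \<P>(\<omega> in M. \<forall>k\<le>i. X k \<omega> = x k) \<noteq> 0 \<and>
      \<P>(\<omega> in M. \<forall>k\<le>i. X k \<omega> = x' k) \<noteq> 0})"

definition mixing_matrix ::
  "'a measure \<Rightarrow> 'b set \<Rightarrow> (nat \<Rightarrow> 'a \<Rightarrow> 'b) \<Rightarrow> nat \<Rightarrow> nat \<Rightarrow> real" where
  "mixing_matrix M S X i j = (if i < j then eta M S X i j else if i = j then 1 else 0)"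

definition c_lipschitz :: "'b set \<Rightarrow> (nat \<Rightarrow> real) \<Rightarrow> ((nat \<Rightarrow> 'b) \<Rightarrow> real) \<Rightarrow> bool" where
  "c_lipschitz S c \<phi> \<longleftrightarrow>
     (\<forall>i. \<forall>x \<in> UNIV \<rightarrow>\<^sub>E S. \<forall>x' \<in> UNIV \<rightarrow>\<^sub>E S.
        differ_only_at i x x' \<longrightarrow> \<bar>\<phi> x - \<phi> x'\<bar> \<le> c i)"

end

(* Let F_n be the sigma-algebra of the first n coordinates and d = Delta |c|. Replacing the coordinates
   after i one at a time by a fixed letter shows that changing the letter at i in a conditioning word
   changes the conditional expectation of phi(X) by at most 2 d_i. Hence, given F_i, the martingale
   E(phi(X) | F_{i+1}) lies in an interval of length 2 d_i, and Hoeffding's lemma bounds the moment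
   generating function of phi(X) - E phi(X) by exp(s^2 |d|^2 / 2). The part of the telescoping that
   depends on the far future is negligible for bounded phi because the rows of Delta have arbitrarily
   small entries; unbounded phi is reached by truncation and Fatou's lemma. No continuity of phi in the
   far coordinates is needed, since E(phi(X) | F_n) converges to phi(X) in L^1. *)

theory Submission
  imports Defs "HOL-Real_Asymp.Real_Asymp"
begin

text \<open>A change of the letter at i alters the conditional law of the whole future, while eta_ij
  controls only functions of the coordinates from j on. Freezing the coordinates between i and j
  produces such functions, and two consecutive ones differ by at most c_j. A total variation
  distance eta_ij moves an integral by at most eta_ij times the length of the range; the range
  [-c_j, c_j] has length 2 c_j, and this is the origin of the factor 2 in 2 d_i. Hoeffding's lemma
  turns it into (2 d_i)^2 / 8 = d_i^2 / 2, hence the 2 in the denominator of the final exponent.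
  What remains after m replacements still depends on the far future, and the Lipschitz condition
  does not bound it: for c = 0, phi may be any function insensitive to finitely many coordinates.
  Only the sup norm K of phi is available there. The resulting moment bound does not contain K, so
  the truncation can be undone. The limits are therefore taken in this order: m for fixed i and K,
  then the number of revealed coordinates, then K.\<close>

section \<open>Total variation, and averages over countable partitions\<close>

text \<open>A discrete layer-cake argument: after rescaling to [0,1], the integrand is within 1/m of
  the average of m indicators of superlevel sets, and each of those changes its integral by at most
  \<open>e\<close>.\<close>

lemma abs_integral_diff_le_total_variation:
  fixes h :: "'a \<Rightarrow> real"
  assumes "prob_space \<mu>" "prob_space \<nu>" and sets_eq: "sets \<mu> = sets \<nu>"
    and tv: "\<And>A. A \<in> sets \<mu> \<Longrightarrow> \<bar>measure \<mu> A - measure \<nu> A\<bar> \<le> e"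
    and [measurable]: "h \<in> borel_measurable \<mu>"
    and h: "\<And>x. x \<in> space \<mu> \<Longrightarrow> a \<le> h x \<and> h x \<le> b"
  shows "\<bar>(\<integral>x. h x \<partial>\<mu>) - (\<integral>x. h x \<partial>\<nu>)\<bar> \<le> (b - a) * e"
proof -
  interpret \<mu>: prob_space \<mu> by fact
  interpret \<nu>: prob_space \<nu> by fact
  have meas_eq: "borel_measurable \<nu> = borel_measurable \<mu>"
    using sets_eq by (intro measurable_cong_sets) auto
  have space_eq: "space \<nu> = space \<mu>"
    using sets_eq_imp_space_eq[OF sets_eq] by simp
  have "0 \<le> e" using tv[of "{}"] by simp
  have unit: "\<bar>(\<integral>x. k x \<partial>\<mu>) - (\<integral>x. k x \<partial>\<nu>)\<bar> \<le> e"
    if [measurable]: "k \<in> borel_measurable \<mu>" and k: "\<And>x. x \<in> space \<mu> \<Longrightarrow> 0 \<le> k x \<and> k x \<le> 1"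
    for k :: "'a \<Rightarrow> real"
  proof (rule field_le_epsilon)
    fix d :: real assume "0 < d"
    \<comment> \<open>Each of the two integrals is approximated with error 1/m, so 2/m has to be at
      most \<open>d\<close>.\<close>
    then obtain m :: nat where m: "2 / d < real m" using reals_Archimedean2 by blast
    with \<open>0 < d\<close> have "0 < m" by (metis divide_pos_pos gr0I less_numeral_extra(3) of_nat_0 order_less_trans zero_less_numeral)
    define A where "A j = {x \<in> space \<mu>. real j \<le> real m * k x}" for j
    have A[measurable]: "A j \<in> sets \<mu>" for j unfolding A_def by measurable
    \<comment> \<open>\<open>r\<close> is \<open>k\<close> rounded down to a multiple of 1/m: the
      number of sets \<open>A j\<close> containing \<open>x\<close> is the floor of
      \<open>real m * k x\<close>.\<close>
    define r where "r x = (\<Sum>j = 1..m. indicator (A j) x) / real m" for x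
    have r_eq: "r x = of_int \<lfloor>real m * k x\<rfloor> / real m" if "x \<in> space \<mu>" for x
    proof -
      have ge0: "0 \<le> \<lfloor>real m * k x\<rfloor>" using k[OF that] by simp
      have le: "\<lfloor>real m * k x\<rfloor> \<le> int m"
        using mult_left_le[of "k x" "real m"] k[OF that] by (simp add: floor_le_iff)
      have "real m * k x \<le> real m" using mult_left_le[of "k x" "real m"] k[OF that] by simp
      then have "{j \<in> {1..m}. real j \<le> real m * k x} = {1..nat \<lfloor>real m * k x\<rfloor>}"
        using ge0 le by (auto simp: le_nat_iff le_floor_iff)
      moreover have "(\<Sum>j = 1..m. indicator (A j) x) = real (card {j \<in> {1..m}. real j \<le> real m * k x})"
        using that by (simp add: A_def indicator_def sum.If_cases Int_def)
      ultimately show ?thesis using ge0 by (simp add: r_def)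
    qed
    have close: "\<bar>k x - r x\<bar> \<le> 1 / real m" if "x \<in> space \<mu>" for x
    proof -
      have "k x - r x = (real m * k x - of_int \<lfloor>real m * k x\<rfloor>) / real m"
        using \<open>0 < m\<close> by (simp add: r_eq[OF that] field_simps)
      moreover have "0 \<le> real m * k x - of_int \<lfloor>real m * k x\<rfloor>"
        "real m * k x - of_int \<lfloor>real m * k x\<rfloor> \<le> 1" by linarith+
      ultimately show ?thesis using \<open>0 < m\<close> by (simp add: field_simps)
    qed
    have approx: "\<bar>(\<integral>x. k x \<partial>\<rho>) - (\<Sum>j = 1..m. measure \<rho> (A j)) / real m\<bar> \<le> 1 / real m"
      if "prob_space \<rho>" and \<rho>: "sets \<rho> = sets \<mu>" for \<rho>
    proof -
      interpret \<rho>: prob_space \<rho> by fact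
      have sp: "space \<rho> = space \<mu>" using sets_eq_imp_space_eq[OF \<rho>] .
      have [measurable]: "k \<in> borel_measurable \<rho>" "A j \<in> sets \<rho>" for j
        using \<rho> by (simp_all cong: measurable_cong_sets)
      have ik: "integrable \<rho> k"
        by (rule \<rho>.integrable_const_bound[where B = 1]) (use k sp in \<open>auto intro!: AE_I2\<close>)
      have ind: "integrable \<rho> (indicator (A j) :: 'a \<Rightarrow> real)" for j
        by (simp add: integrable_indicator_iff \<rho>.emeasure_finite less_top[symmetric])
      have ir: "integrable \<rho> r" unfolding r_def using ind by simp
      have "(\<integral>x. r x \<partial>\<rho>) = (\<Sum>j = 1..m. measure \<rho> (A j)) / real m"
        unfolding r_def using ind by (simp add: Bochner_Integration.integral_sum)
      then have "(\<integral>x. k x \<partial>\<rho>) - (\<Sum>j = 1..m. measure \<rho> (A j)) / real m = (\<integral>x. k x - r x \<partial>\<rho>)"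
        using ik ir by simp
      also have "\<bar>\<dots>\<bar> \<le> (\<integral>x. \<bar>k x - r x\<bar> \<partial>\<rho>)" by (rule integral_abs_bound)
      also have "\<dots> \<le> (\<integral>x. 1 / real m \<partial>\<rho>)"
        by (rule integral_mono) (use ik ir close sp in auto)
      finally show ?thesis by (simp add: \<rho>.prob_space)
    qed
    have "\<bar>(\<Sum>j = 1..m. measure \<mu> (A j)) / real m - (\<Sum>j = 1..m. measure \<nu> (A j)) / real m\<bar>
        = \<bar>\<Sum>j = 1..m. measure \<mu> (A j) - measure \<nu> (A j)\<bar> / real m"
      by (simp add: sum_subtractf diff_divide_distrib[symmetric])
    also have "\<dots> \<le> (\<Sum>j = 1..m. e) / real m"
      by (intro divide_right_mono order.trans[OF sum_abs] sum_mono tv) auto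
    also have "\<dots> = e" using \<open>0 < m\<close> by simp
    finally have mid: "\<bar>(\<Sum>j = 1..m. measure \<mu> (A j)) / real m - (\<Sum>j = 1..m. measure \<nu> (A j)) / real m\<bar> \<le> e" .
    have "2 / real m \<le> d" using m \<open>0 < d\<close> \<open>0 < m\<close> by (simp add: field_simps)
    then show "\<bar>(\<integral>x. k x \<partial>\<mu>) - (\<integral>x. k x \<partial>\<nu>)\<bar> \<le> e + d"
      using approx[OF \<mu>.prob_space_axioms refl] approx[OF \<nu>.prob_space_axioms sets_eq[symmetric]] mid
      by linarith
  qed
  have "a \<le> b"
    using h \<mu>.not_empty by (meson ex_in_conv order.trans)
  show ?thesis
  \<comment> \<open>The affine rescaling to [0,1] divides by \<open>b - a\<close>.\<close>
  proof (cases "a = b")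
    case True
    then have "h x = a" if "x \<in> space \<mu>" for x using h[OF that] by simp
    then have "(\<integral>x. h x \<partial>\<mu>) = (\<integral>x. a \<partial>\<mu>)" "(\<integral>x. h x \<partial>\<nu>) = (\<integral>x. a \<partial>\<nu>)"
      using space_eq by (auto intro: Bochner_Integration.integral_cong[OF refl] simp del: lebesgue_integral_const)
    then show ?thesis using True by (simp add: \<mu>.prob_space \<nu>.prob_space)
  next
    case False
    with \<open>a \<le> b\<close> have "a < b" by simp
    define k where "k x = (h x - a) / (b - a)" for x
    have h_eq: "h = (\<lambda>x. a + (b - a) * k x)" using \<open>a < b\<close> by (auto simp: k_def)
    have k: "0 \<le> k x \<and> k x \<le> 1" if "x \<in> space \<mu>" for x
      using h[OF that] \<open>a < b\<close> by (auto simp: k_def)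
    have [measurable]: "k \<in> borel_measurable \<mu>" unfolding k_def by measurable
    have i1: "integrable \<mu> k"
      by (rule \<mu>.integrable_const_bound[where B = 1]) (use k in \<open>auto intro!: AE_I2\<close>)
    have i2: "integrable \<nu> k"
      by (rule \<nu>.integrable_const_bound[where B = 1]) (use k space_eq meas_eq in \<open>auto intro!: AE_I2\<close>)
    have "(\<integral>x. h x \<partial>\<mu>) - (\<integral>x. h x \<partial>\<nu>) = (b - a) * ((\<integral>x. k x \<partial>\<mu>) - (\<integral>x. k x \<partial>\<nu>))"
      unfolding h_eq using i1 i2 by (simp add: \<mu>.prob_space \<nu>.prob_space algebra_simps)
    then show ?thesis using unit[OF _ k] \<open>a < b\<close> by (simp add: abs_mult)
  qed
qed

lemma (in prob_space) integral_uniform_measure: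
  fixes h :: "'a \<Rightarrow> real"
  assumes A[measurable]: "A \<in> events" and h[measurable]: "h \<in> borel_measurable M" and "prob A \<noteq> 0"
  shows "(\<integral>x. h x \<partial>uniform_measure M A) = (\<integral>x. indicator A x * h x \<partial>M) / prob A"
proof -
  have "uniform_measure M A = density M (\<lambda>x. ennreal (indicator A x / prob A))"
    unfolding uniform_measure_def
    using \<open>prob A \<noteq> 0\<close>
    by (intro density_cong AE_I2)
       (auto simp: emeasure_eq_measure indicator_def divide_ennreal[of 1, simplified] zero_less_measure_iff)
  then have "(\<integral>x. h x \<partial>uniform_measure M A) = (\<integral>x. (indicator A x / prob A) *\<^sub>R h x \<partial>M)"
    by (simp add: integral_density)
  also have "\<dots> = (\<integral>x. indicator A x * h x \<partial>M) / prob A"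
    by (simp flip: integral_divide_zero)
  finally show ?thesis .
qed

text \<open>A function measurable for the sigma-algebra generated by \<open>W\<close> is constant on
  the fibres of \<open>W\<close>, so testing the conditional expectation against one fibre yields
  its value there as an average. Since \<open>T\<close> is countable, the null fibres can be
  discarded together.\<close>

lemma (in prob_space) cond_exp_countable_partition:
  fixes h :: "'a \<Rightarrow> real"
  assumes "countable T" and W[measurable]: "W \<in> measurable M (count_space T)"
    and h: "integrable M h"
  defines "F \<equiv> vimage_algebra (space M) W (count_space T)"
    and "E \<equiv> (\<lambda>\<omega>. {\<omega>' \<in> space M. W \<omega>' = W \<omega>})"
  shows "AE \<omega> in M. prob (E \<omega>) \<noteq> 0 \<and> real_cond_exp M F h \<omega> = (\<integral>x. h x \<partial>uniform_measure M (E \<omega>))"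
proof -
  have WT: "W \<in> space M \<rightarrow> T" using measurable_space[OF W] by auto
  have setsF: "sets F = {W -` A \<inter> space M | A. A \<subseteq> T}"
    unfolding F_def using WT by (simp add: sets_vimage_algebra2)
  have [simp]: "space F = space M" by (simp add: F_def)
  have sub: "subalgebra M F"
    unfolding subalgebra_def using measurable_sets[OF W] by (auto simp: setsF)
  interpret finite_measure_subalgebra M F by standard (rule sub)
  have E_F: "E \<omega> \<in> sets F" if "\<omega> \<in> space M" for \<omega>
  proof -
    have "E \<omega> = W -` {W \<omega>} \<inter> space M" by (auto simp: E_def)
    moreover have "{W \<omega>} \<subseteq> T" using WT that by auto
    ultimately show ?thesis unfolding setsF by blast
  qed
  have E_M: "E \<omega> \<in> events" if "\<omega> \<in> space M" for \<omega>
    using E_F[OF that] sub by (auto simp: subalgebra_def)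
  have fib: "W -` {w} \<inter> space M \<in> events" for w
  proof (cases "w \<in> T")
    case False
    then have "W -` {w} \<inter> space M = {}" using WT by auto
    then show ?thesis by simp
  qed (auto intro!: measurable_sets[OF W])
  have "AE \<omega> in M. \<forall>w \<in> T. prob (W -` {w} \<inter> space M) = 0 \<longrightarrow> W \<omega> \<noteq> w"
  proof (subst AE_ball_countable[OF \<open>countable T\<close>], intro ballI)
    fix w
    show "AE \<omega> in M. prob (W -` {w} \<inter> space M) = 0 \<longrightarrow> W \<omega> \<noteq> w"
    proof (cases "prob (W -` {w} \<inter> space M) = 0")
      case True
      then have "W -` {w} \<inter> space M \<in> null_sets M" using fib by (auto simp: emeasure_eq_measure)
      then show ?thesis by (auto dest: AE_not_in)
    qed simp
  qed
  then show ?thesis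
  proof (rule AE_mp[OF _ AE_I2], intro impI conjI)
    fix \<omega> assume \<omega>: "\<omega> \<in> space M" and nz: "\<forall>w \<in> T. prob (W -` {w} \<inter> space M) = 0 \<longrightarrow> W \<omega> \<noteq> w"
    have E_eq: "E \<omega> = W -` {W \<omega>} \<inter> space M" by (auto simp: E_def)
    show pos: "prob (E \<omega>) \<noteq> 0" using nz WT \<omega> unfolding E_eq by auto
    let ?g = "real_cond_exp M F h"
    \<comment> \<open>The level set of \<open>?g\<close> through \<open>\<omega>\<close> belongs to
      \<open>F\<close>, so it is a preimage under \<open>W\<close> and contains the whole fibre
      \<open>E \<omega>\<close>.\<close>
    have "?g -` {?g \<omega>} \<inter> space F \<in> sets F"
      by (rule measurable_sets[OF borel_measurable_cond_exp]) simp
    then obtain A where A: "?g -` {?g \<omega>} \<inter> space M = W -` A \<inter> space M"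
      unfolding setsF by auto
    have "W \<omega> \<in> A" using A \<omega> by auto
    then have const: "?g x = ?g \<omega>" if "x \<in> E \<omega>" for x using A that unfolding E_def by blast
    have "(\<integral>x. indicator (E \<omega>) x * h x \<partial>M) = (\<integral>x. indicator (E \<omega>) x * ?g x \<partial>M)"
      using real_cond_exp_intA[OF h E_F[OF \<omega>]] by (simp add: set_lebesgue_integral_def)
    also have "\<dots> = (\<integral>x. indicator (E \<omega>) x * ?g \<omega> \<partial>M)"
      by (intro Bochner_Integration.integral_cong) (auto simp: indicator_def const)
    also have "\<dots> = prob (E \<omega>) * ?g \<omega>" using E_M[OF \<omega>] by simp
    finally show "?g \<omega> = (\<integral>x. h x \<partial>uniform_measure M (E \<omega>))"
      using pos h E_M[OF \<omega>] by (subst integral_uniform_measure) auto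
  qed
qed

section \<open>Processes with countably many states and their mixing coefficients\<close>

locale discrete_process = prob_space M for M :: "'a measure" +
  fixes S :: "'b set" and X :: "nat \<Rightarrow> 'a \<Rightarrow> 'b"
  assumes countable_S: "countable S"
    and X_measurable[measurable]: "\<And>i. X i \<in> measurable M (count_space S)"
begin

text \<open>Here \<open>n\<close> is the length of the word, so \<open>n = 0\<close> gives the whole
  space, and the conditioning event in \<open>eta M S X i j\<close> is
  \<open>cylinder (Suc i) x\<close>.\<close>

definition cylinder :: "nat \<Rightarrow> (nat \<Rightarrow> 'b) \<Rightarrow> 'a set" where
  "cylinder n x = {\<omega> \<in> space M. \<forall>k<n. X k \<omega> = x k}"

abbreviation given :: "nat \<Rightarrow> (nat \<Rightarrow> 'b) \<Rightarrow> 'a measure" where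
  "given n x \<equiv> uniform_measure M (cylinder n x)"

lemma X_in_S: "\<omega> \<in> space M \<Longrightarrow> X i \<omega> \<in> S"
  using measurable_space[OF X_measurable] by simp

lemma sets_cylinder[measurable]: "cylinder n x \<in> events"
proof -
  have "{\<omega> \<in> space M. X k \<omega> = y} \<in> events" for k y
  proof (cases "y \<in> S")
    case True
    then have "X k -` {y} \<inter> space M \<in> events" by (intro measurable_sets[OF X_measurable]) auto
    moreover have "X k -` {y} \<inter> space M = {\<omega> \<in> space M. X k \<omega> = y}" by auto
    ultimately show ?thesis by simp
  next
    case False
    then have "{\<omega> \<in> space M. X k \<omega> = y} = {}" using X_in_S by auto
    then show ?thesis by simp
  qed
  then have "{\<omega> \<in> space M. \<forall>k\<in>{..<n}. X k \<omega> = x k} \<in> events"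
    by (intro sets.sets_Collect_finite_All) auto
  then show ?thesis by (simp add: cylinder_def)
qed

lemma prob_space_given: "prob (cylinder n x) \<noteq> 0 \<Longrightarrow> prob_space (given n x)"
  by (rule prob_space_uniform_measure) (auto simp: emeasure_eq_measure)

lemma future_measurable[measurable]: "(\<lambda>\<omega> k. X (j + k) \<omega>) \<in> measurable M (seq_space S)"
  by (rule measurable_PiM_single') (auto simp: X_in_S)

text \<open>A real \<open>Sup\<close> is known to be an upper bound only for a set bounded above;
  here 1 is a bound, because each element is 0 or the distance of two numbers in [0,1].\<close>

lemma eta_nonneg: "0 \<le> eta M S X i j"
  and cond_prob_diff_le_eta:
    "\<lbrakk>x \<in> {..i} \<rightarrow>\<^sub>E S; x' \<in> {..i} \<rightarrow>\<^sub>E S; differ_only_at i x x'; A \<in> sets (seq_space S);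
      \<P>(\<omega> in M. \<forall>k\<le>i. X k \<omega> = x k) \<noteq> 0; \<P>(\<omega> in M. \<forall>k\<le>i. X k \<omega> = x' k) \<noteq> 0\<rbrakk>
    \<Longrightarrow> \<bar>\<P>(\<omega> in M. (\<lambda>k. X (j + k) \<omega>) \<in> A \<bar> \<forall>k\<le>i. X k \<omega> = x k)
      - \<P>(\<omega> in M. (\<lambda>k. X (j + k) \<omega>) \<in> A \<bar> \<forall>k\<le>i. X k \<omega> = x' k)\<bar> \<le> eta M S X i j"
proof -
  have cp: "0 \<le> \<P>(\<omega> in M. P \<omega> \<bar> Q \<omega>) \<and> \<P>(\<omega> in M. P \<omega> \<bar> Q \<omega>) \<le> 1"
    if "{\<omega> \<in> space M. Q \<omega>} \<in> events" for P Q
  proof -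
    have "\<P>(\<omega> in M. P \<omega> \<and> Q \<omega>) \<le> \<P>(\<omega> in M. Q \<omega>)"
      using that by (intro finite_measure_mono) auto
    then show ?thesis by (auto simp: cond_prob_def divide_le_eq_1 less_le)
  qed
  have ev: "{\<omega> \<in> space M. \<forall>k\<le>i. X k \<omega> = x k} \<in> events" for x
    using sets_cylinder[of "Suc i" x] by (simp add: cylinder_def less_Suc_eq_le)
  let ?C = "insert 0
     {\<bar>\<P>(\<omega> in M. (\<lambda>k. X (j + k) \<omega>) \<in> A \<bar> \<forall>k\<le>i. X k \<omega> = x k)
       - \<P>(\<omega> in M. (\<lambda>k. X (j + k) \<omega>) \<in> A \<bar> \<forall>k\<le>i. X k \<omega> = x' k)\<bar> | x x' A.
      x \<in> {..i} \<rightarrow>\<^sub>E S \<and> x' \<in> {..i} \<rightarrow>\<^sub>E S \<and> differ_only_at i x x' \<and>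
      A \<in> sets (seq_space S) \<and>
      \<P>(\<omega> in M. \<forall>k\<le>i. X k \<omega> = x k) \<noteq> 0 \<and>
      \<P>(\<omega> in M. \<forall>k\<le>i. X k \<omega> = x' k) \<noteq> 0}"
  have bdd: "bdd_above ?C"
  proof (rule bdd_aboveI[of _ 1])
    fix z assume "z \<in> ?C"
    then show "z \<le> 1"
    proof (elim insertE CollectE exE conjE)
      fix x x' A assume "z = \<bar>\<P>(\<omega> in M. (\<lambda>k. X (j + k) \<omega>) \<in> A \<bar> \<forall>k\<le>i. X k \<omega> = x k)
       - \<P>(\<omega> in M. (\<lambda>k. X (j + k) \<omega>) \<in> A \<bar> \<forall>k\<le>i. X k \<omega> = x' k)\<bar>"
      then show "z \<le> 1"
        using cp[OF ev[of x], of "\<lambda>\<omega>. (\<lambda>k. X (j + k) \<omega>) \<in> A"]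
          cp[OF ev[of x'], of "\<lambda>\<omega>. (\<lambda>k. X (j + k) \<omega>) \<in> A"] by linarith
    qed simp
  qed
  show "0 \<le> eta M S X i j" unfolding eta_def by (rule cSup_upper[OF _ bdd]) simp
  show "\<bar>\<P>(\<omega> in M. (\<lambda>k. X (j + k) \<omega>) \<in> A \<bar> \<forall>k\<le>i. X k \<omega> = x k)
      - \<P>(\<omega> in M. (\<lambda>k. X (j + k) \<omega>) \<in> A \<bar> \<forall>k\<le>i. X k \<omega> = x' k)\<bar> \<le> eta M S X i j"
    if "x \<in> {..i} \<rightarrow>\<^sub>E S" "x' \<in> {..i} \<rightarrow>\<^sub>E S" "differ_only_at i x x'" "A \<in> sets (seq_space S)"
      "\<P>(\<omega> in M. \<forall>k\<le>i. X k \<omega> = x k) \<noteq> 0" "\<P>(\<omega> in M. \<forall>k\<le>i. X k \<omega> = x' k) \<noteq> 0"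
    unfolding eta_def by (rule cSup_upper[OF _ bdd], rule insertI2) (use that in blast)
qed

text \<open>The two conditional laws of the sequence from \<open>j\<close> on have total variation
  distance at most \<open>eta M S X i j\<close>, and \<open>2 * B\<close> is the length of the range
  [-B, B] of \<open>h\<close>.\<close>

lemma integral_future_diff_le_eta:
  assumes x: "x \<in> {..i} \<rightarrow>\<^sub>E S" "x' \<in> {..i} \<rightarrow>\<^sub>E S" "differ_only_at i x x'"
    and pos: "prob (cylinder (Suc i) x) \<noteq> 0" "prob (cylinder (Suc i) x') \<noteq> 0"
    and h[measurable]: "h \<in> borel_measurable (seq_space S)"
    and bd: "\<And>y. y \<in> space (seq_space S) \<Longrightarrow> \<bar>h y\<bar> \<le> B"
  shows "\<bar>(\<integral>\<omega>. h (\<lambda>k. X (j + k) \<omega>) \<partial>given (Suc i) x) - (\<integral>\<omega>. h (\<lambda>k. X (j + k) \<omega>) \<partial>given (Suc i) x')\<bar>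
    \<le> 2 * B * eta M S X i j"
proof -
  let ?Y = "\<lambda>\<omega> k. X (j + k) \<omega>"
  let ?d = "\<lambda>x. distr (given (Suc i) x) (seq_space S) ?Y"
  have Y[measurable]: "?Y \<in> measurable (given (Suc i) x) (seq_space S)" for x by simp
  have cyl: "cylinder (Suc i) x = {\<omega> \<in> space M. \<forall>k\<le>i. X k \<omega> = x k}" for x
    by (simp add: cylinder_def less_Suc_eq_le)
  have meas: "measure (?d x) A = \<P>(\<omega> in M. ?Y \<omega> \<in> A \<bar> \<forall>k\<le>i. X k \<omega> = x k)"
    if "prob (cylinder (Suc i) x) \<noteq> 0" "A \<in> sets (seq_space S)" for x A
  proof -
    have ev: "?Y -` A \<inter> space M \<in> events" using that by (intro measurable_sets[OF future_measurable])
    have "measure (?d x) A = measure (given (Suc i) x) (?Y -` A \<inter> space M)"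
      using that by (subst measure_distr) auto
    also have "\<dots> = prob (cylinder (Suc i) x \<inter> (?Y -` A \<inter> space M)) / prob (cylinder (Suc i) x)"
      using that ev by (subst measure_uniform_measure) (auto simp: emeasure_eq_measure)
    also have "cylinder (Suc i) x \<inter> (?Y -` A \<inter> space M) = {\<omega> \<in> space M. ?Y \<omega> \<in> A \<and> (\<forall>k\<le>i. X k \<omega> = x k)}"
      unfolding cyl by auto
    finally show ?thesis unfolding cond_prob_def cyl .
  qed
  have "\<bar>(\<integral>y. h y \<partial>?d x) - (\<integral>y. h y \<partial>?d x')\<bar> \<le> (B - (- B)) * eta M S X i j"
  proof (rule abs_integral_diff_le_total_variation)
    show "prob_space (?d x)" "prob_space (?d x')"
      using pos prob_space_given by (auto intro!: prob_space.prob_space_distr)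
    show "\<bar>measure (?d x) A - measure (?d x') A\<bar> \<le> eta M S X i j" if "A \<in> sets (?d x)" for A
    proof -
      have "A \<in> sets (seq_space S)" using that by simp
      then show ?thesis
        using cond_prob_diff_le_eta[OF x _ pos[unfolded cyl]] by (simp add: meas[OF pos(1)] meas[OF pos(2)])
    qed
    show "- B \<le> h y \<and> h y \<le> B" if "y \<in> space (?d x)" for y
      using bd[of y] that by (auto simp: abs_le_iff)
  qed simp_all
  then show ?thesis by (simp add: integral_distr)
qed

text \<open>The three terms are the costs of three operations: overwriting the first letters by
  \<open>x\<close> (only coordinate \<open>i\<close> really changes), freezing \<open>m\<close>
  further coordinates one by one, and comparing the two laws on what is left, where only the bound
  \<open>K\<close> helps.\<close>

lemma integral_diff_le_mixing:
  assumes \<phi>[measurable]: "\<phi> \<in> borel_measurable (seq_space S)"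
    and bd: "\<And>y. \<bar>\<phi> y\<bar> \<le> K"
    and lip: "c_lipschitz S c \<phi>"
    and c: "\<And>i. 0 \<le> c i"
    and x: "x \<in> {..i} \<rightarrow>\<^sub>E S" "x' \<in> {..i} \<rightarrow>\<^sub>E S" "differ_only_at i x x'"
    and pos: "prob (cylinder (Suc i) x) \<noteq> 0" "prob (cylinder (Suc i) x') \<noteq> 0"
  shows "\<bar>(\<integral>\<omega>. \<phi> (\<lambda>k. X k \<omega>) \<partial>given (Suc i) x) - (\<integral>\<omega>. \<phi> (\<lambda>k. X k \<omega>) \<partial>given (Suc i) x')\<bar>
    \<le> c i + 2 * (\<Sum>j = Suc i..<Suc i + m. eta M S X i j * c j) + 2 * K * eta M S X i (Suc i + m)"
proof -
  let ?U = "given (Suc i) x" and ?U' = "given (Suc i) x'"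
  interpret U: prob_space ?U using pos prob_space_given by simp
  interpret U': prob_space ?U' using pos prob_space_given by simp
  define D where "D h = (\<integral>\<omega>. h \<omega> \<partial>?U) - (\<integral>\<omega>. h \<omega> \<partial>?U')" for h :: "'a \<Rightarrow> real"
  \<comment> \<open>\<open>\<Psi> j\<close> has the word \<open>x\<close> up to \<open>i\<close>,
    the letter \<open>x i\<close> (a letter known to lie in \<open>S\<close>) strictly between
    \<open>i\<close> and \<open>j\<close>, and \<open>y\<close> from \<open>j\<close> on. Fed with
    the process from time \<open>j\<close> on, it depends only on the future that
    \<open>eta M S X i j\<close> controls.\<close>
  define \<Psi> where "\<Psi> j y = \<phi> (\<lambda>k. if k \<le> i then x k else if k < j then x i else y (k - j))" for j y
  have xS: "x k \<in> S" if "k \<le> i" for k using x(1) that by auto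
  have \<Psi>[measurable]: "\<Psi> j \<in> borel_measurable (seq_space S)" for j
  proof -
    have "(\<lambda>y k. if k \<le> i then x k else if k < j then x i else y (k - j)) \<in> measurable (seq_space S) (seq_space S)"
    proof (rule measurable_PiM_single')
      show "(\<lambda>y. if k \<le> i then x k else if k < j then x i else y (k - j)) \<in> measurable (seq_space S) (count_space S)" for k
        using xS by (cases "k \<le> i"; cases "k < j") auto
    qed (auto simp: space_PiM xS PiE_def Pi_iff)
    then show ?thesis unfolding \<Psi>_def[abs_def] by (rule measurable_compose) measurable
  qed
  have \<Psi>_bd: "\<bar>\<Psi> j y\<bar> \<le> K" for j y unfolding \<Psi>_def by (rule bd)
  have K: "0 \<le> K" using bd[of undefined] by linarith
  have int: "integrable ?U h \<and> integrable ?U' h"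
    if [measurable]: "h \<in> borel_measurable M" and h: "\<And>\<omega>. \<bar>h \<omega>\<bar> \<le> K" for h :: "'a \<Rightarrow> real"
    using h by (auto intro!: U.integrable_const_bound[where B = K] U'.integrable_const_bound[where B = K])
  have int\<Psi>: "integrable ?U (\<lambda>\<omega>. \<Psi> j (\<lambda>k. X (j + k) \<omega>))" "integrable ?U' (\<lambda>\<omega>. \<Psi> j (\<lambda>k. X (j + k) \<omega>))" for j
    using int[of "\<lambda>\<omega>. \<Psi> j (\<lambda>k. X (j + k) \<omega>)"] \<Psi>_bd by auto
  have step: "\<bar>D (\<lambda>\<omega>. \<Psi> j (\<lambda>k. X (j + k) \<omega>)) - D (\<lambda>\<omega>. \<Psi> (Suc j) (\<lambda>k. X (Suc j + k) \<omega>))\<bar>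
      \<le> 2 * c j * eta M S X i j" if "i < j" for j
  proof -
    \<comment> \<open>\<open>\<Psi> (Suc j)\<close> reads a future that starts one place later; the
      left shift makes both interpolants functions of the sequence from \<open>j\<close> on.\<close>
    define G where "G y = \<Psi> j y - \<Psi> (Suc j) (\<lambda>k. y (Suc k))" for y
    have shift: "(\<lambda>y k. y (Suc k)) \<in> measurable (seq_space S) (seq_space S)"
      by (rule measurable_PiM_single') (auto simp: space_PiM)
    have [measurable]: "G \<in> borel_measurable (seq_space S)"
      unfolding G_def using measurable_compose[OF shift \<Psi>] by measurable
    have "\<bar>G y\<bar> \<le> c j" if y: "y \<in> space (seq_space S)" for y
    proof -
      let ?u = "\<lambda>k. if k \<le> i then x k else if k < j then x i else y (k - j)"
      let ?v = "\<lambda>k. if k \<le> i then x k else if k < Suc j then x i else y (Suc (k - Suc j))"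
      have yS: "y k \<in> S" for k using y by (auto simp: space_PiM)
      have uv: "?u \<in> UNIV \<rightarrow>\<^sub>E S" "?v \<in> UNIV \<rightarrow>\<^sub>E S" using xS yS by auto
      have eq: "?u k = ?v k" if "k \<noteq> j" for k
        using that by (cases "k < j") (auto simp: Suc_diff_Suc not_less le_less)
      have G: "G y = \<phi> ?u - \<phi> ?v" by (simp add: G_def \<Psi>_def)
      show ?thesis
      proof (cases "?u j = ?v j")
        case True
        have "?u = ?v"
        proof
          show "?u k = ?v k" for k
            using True eq[of k] by (cases "k = j") blast+
        qed
        then show ?thesis using c[of j] unfolding G by simp
      next
        case False
        then have "differ_only_at j ?u ?v" using eq unfolding differ_only_at_def by blast
        then show ?thesis using lip uv unfolding G c_lipschitz_def by blast
      qed
    qed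
    then have "\<bar>D (\<lambda>\<omega>. G (\<lambda>k. X (j + k) \<omega>))\<bar> \<le> 2 * c j * eta M S X i j"
      unfolding D_def by (intro integral_future_diff_le_eta x pos) auto
    moreover have "D (\<lambda>\<omega>. G (\<lambda>k. X (j + k) \<omega>))
      = D (\<lambda>\<omega>. \<Psi> j (\<lambda>k. X (j + k) \<omega>)) - D (\<lambda>\<omega>. \<Psi> (Suc j) (\<lambda>k. X (Suc j + k) \<omega>))"
      using int\<Psi>[of j] int\<Psi>[of "Suc j"] by (simp add: D_def G_def)
    ultimately show ?thesis by simp
  qed
  have tele: "\<bar>D (\<lambda>\<omega>. \<Psi> (Suc i) (\<lambda>k. X (Suc i + k) \<omega>))\<bar>
      \<le> 2 * (\<Sum>j = Suc i..<Suc i + m. eta M S X i j * c j)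
        + \<bar>D (\<lambda>\<omega>. \<Psi> (Suc i + m) (\<lambda>k. X (Suc i + m + k) \<omega>))\<bar>" for m
  proof (induction m)
    case (Suc m)
    then show ?case using step[of "Suc i + m"] by (simp add: algebra_simps)
  qed simp
  have last: "\<bar>D (\<lambda>\<omega>. \<Psi> (Suc i + m) (\<lambda>k. X (Suc i + m + k) \<omega>))\<bar> \<le> 2 * K * eta M S X i (Suc i + m)"
    unfolding D_def by (intro integral_future_diff_le_eta x pos \<Psi>_bd) auto
  let ?\<psi> = "\<lambda>\<omega>. \<Psi> (Suc i) (\<lambda>k. X (Suc i + k) \<omega>)"
  have \<psi>: "?\<psi> \<omega> = \<phi> (\<lambda>k. if k \<le> i then x k else X k \<omega>)" for \<omega>
    unfolding \<Psi>_def by (rule arg_cong[where f = \<phi>]) auto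
  have [measurable]: "(\<lambda>\<omega> k. X k \<omega>) \<in> measurable M (seq_space S)"
    using future_measurable[of 0] by simp
  have int\<phi>: "integrable ?U' (\<lambda>\<omega>. \<phi> (\<lambda>k. X k \<omega>))"
    using int[of "\<lambda>\<omega>. \<phi> (\<lambda>k. X k \<omega>)"] bd by auto
  \<comment> \<open>Under \<open>?U\<close> the process starts with \<open>x\<close>, so overwriting
    its first letters by \<open>x\<close> changes nothing. Under \<open>?U'\<close> it starts with
    \<open>x'\<close>, and overwriting changes coordinate \<open>i\<close> alone, at a cost of
    \<open>c i\<close>.\<close>
  have "(\<integral>\<omega>. \<phi> (\<lambda>k. X k \<omega>) \<partial>?U) = (\<integral>\<omega>. ?\<psi> \<omega> \<partial>?U)"
  proof (rule integral_cong_AE)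
    have "\<phi> (\<lambda>k. X k \<omega>) = ?\<psi> \<omega>" if "\<omega> \<in> cylinder (Suc i) x" for \<omega>
      unfolding \<psi> using that by (intro arg_cong[where f = \<phi>]) (auto simp: cylinder_def)
    then show "AE \<omega> in ?U. \<phi> (\<lambda>k. X k \<omega>) = ?\<psi> \<omega>"
      by (intro AE_uniform_measureI AE_I2) auto
    show "?\<psi> \<in> borel_measurable ?U" by measurable
  qed simp
  moreover have "\<bar>(\<integral>\<omega>. ?\<psi> \<omega> \<partial>?U') - (\<integral>\<omega>. \<phi> (\<lambda>k. X k \<omega>) \<partial>?U')\<bar> \<le> c i"
  proof -
    have ptw: "\<bar>?\<psi> \<omega> - \<phi> (\<lambda>k. X k \<omega>)\<bar> \<le> c i" if "\<omega> \<in> cylinder (Suc i) x'" for \<omega>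
    proof -
      have \<omega>: "\<omega> \<in> space M" "X k \<omega> = x' k" if "k \<le> i" for k
        using \<open>\<omega> \<in> cylinder (Suc i) x'\<close> that by (auto simp: cylinder_def)
      have "differ_only_at i (\<lambda>k. if k \<le> i then x k else X k \<omega>) (\<lambda>k. X k \<omega>)"
        using x(3) \<omega> by (auto simp: differ_only_at_def)
      moreover have "(\<lambda>k. if k \<le> i then x k else X k \<omega>) \<in> UNIV \<rightarrow>\<^sub>E S" "(\<lambda>k. X k \<omega>) \<in> UNIV \<rightarrow>\<^sub>E S"
        using \<omega>(1)[of i] xS X_in_S by auto
      ultimately show ?thesis
        using lip unfolding \<psi> c_lipschitz_def by blast
    qed
    have "\<bar>(\<integral>\<omega>. ?\<psi> \<omega> \<partial>?U') - (\<integral>\<omega>. \<phi> (\<lambda>k. X k \<omega>) \<partial>?U')\<bar> = \<bar>\<integral>\<omega>. ?\<psi> \<omega> - \<phi> (\<lambda>k. X k \<omega>) \<partial>?U'\<bar>"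
      by (subst Bochner_Integration.integral_diff[OF int\<Psi>(2) int\<phi>]) (rule refl)
    also have "\<dots> \<le> (\<integral>\<omega>. \<bar>?\<psi> \<omega> - \<phi> (\<lambda>k. X k \<omega>)\<bar> \<partial>?U')" by (rule integral_abs_bound)
    also have "\<dots> \<le> c i"
    proof (rule U'.integral_le_const)
      show "integrable ?U' (\<lambda>\<omega>. \<bar>?\<psi> \<omega> - \<phi> (\<lambda>k. X k \<omega>)\<bar>)"
        by (intro integrable_abs Bochner_Integration.integrable_diff int\<Psi> int\<phi>)
      show "AE \<omega> in ?U'. \<bar>?\<psi> \<omega> - \<phi> (\<lambda>k. X k \<omega>)\<bar> \<le> c i"
        using ptw by (intro AE_uniform_measureI AE_I2) auto
    qed
    finally show ?thesis .
  qed
  ultimately have "\<bar>(\<integral>\<omega>. \<phi> (\<lambda>k. X k \<omega>) \<partial>?U) - (\<integral>\<omega>. \<phi> (\<lambda>k. X k \<omega>) \<partial>?U')\<bar> \<le> \<bar>D ?\<psi>\<bar> + c i"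
    unfolding D_def by linarith
  then show ?thesis using tele[of m] last by linarith
qed

end

section \<open>Infinite matrices of finite operator norm\<close>

text \<open>A unit vector with a divergent entry or an image outside \<open>ell2\<close> would
  contribute the value \<open>\<infinity>\<close> to the supremum, so finiteness excludes it.
  Homogeneity carries this from the unit sphere to every nonzero \<open>v\<close>.\<close>

lemma matrix_norm_finite:
  assumes fin: "matrix_norm D < \<infinity>" and v: "v \<in> ell2"
  shows "summable (\<lambda>j. D i j * v j)"
    and "matrix_apply D v \<in> ell2"
    and "ell2_norm (matrix_apply D v) \<le> real_of_ereal (matrix_norm D) * ell2_norm v"
proof -
  have sv: "summable (\<lambda>j. (v j)\<^sup>2)" using v by (simp add: ell2_def)
  have "(\<forall>i. summable (\<lambda>j. D i j * v j)) \<and> matrix_apply D v \<in> ell2 \<and>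
    ell2_norm (matrix_apply D v) \<le> real_of_ereal (matrix_norm D) * ell2_norm v"
  proof (cases "ell2_norm v = 0")
    case True
    then have "v j = 0" for j
      using suminf_eq_zero_iff[OF sv] by (auto simp: ell2_norm_def)
    then show ?thesis by (simp add: matrix_apply_def ell2_def ell2_norm_def)
  next
    case False
    define r where "r = ell2_norm v"
    have r: "r > 0" using False suminf_nonneg[OF sv] by (simp add: r_def ell2_norm_def)
    have r2: "r\<^sup>2 = (\<Sum>j. (v j)\<^sup>2)" using suminf_nonneg[OF sv] by (simp add: r_def ell2_norm_def)
    define u where "u j = v j / r" for j
    have vu: "v = (\<lambda>j. r * u j)" using r by (auto simp: u_def)
    have u: "u \<in> ell2" using sv by (simp add: ell2_def u_def power_divide summable_divide)
    have "(\<Sum>j. (u j)\<^sup>2) = 1"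
      using r by (simp add: u_def power_divide suminf_divide[OF sv] flip: r2)
    then have u1: "ell2_norm u = 1" by (simp add: ell2_norm_def)
    let ?val = "if (\<forall>i. summable (\<lambda>j. D i j * u j)) \<and> matrix_apply D u \<in> ell2
        then ereal (ell2_norm (matrix_apply D u)) else \<infinity>"
    have le: "?val \<le> matrix_norm D"
      unfolding matrix_norm_def using u u1 by (intro SUP_upper2[of u]) auto
    then have sum_u: "summable (\<lambda>j. D i j * u j)" and app_u: "matrix_apply D u \<in> ell2" for i
      using fin by (auto split: if_splits)
    with le have le': "ereal (ell2_norm (matrix_apply D u)) \<le> matrix_norm D" by simp
    then obtain N where N: "matrix_norm D = ereal N" using fin by (cases "matrix_norm D") auto
    have app: "matrix_apply D v = (\<lambda>i. r * matrix_apply D u i)"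
      unfolding vu matrix_apply_def using suminf_mult[OF sum_u] by (simp add: mult.left_commute)
    have sq: "summable (\<lambda>i. (matrix_apply D u i)\<^sup>2)" using app_u by (simp add: ell2_def)
    have "summable (\<lambda>j. D i j * v j)" for i
      unfolding vu using summable_mult[OF sum_u[of i], of r] by (simp add: mult.left_commute)
    moreover have "matrix_apply D v \<in> ell2"
      unfolding app using summable_mult[OF sq, of "r\<^sup>2"] by (simp add: ell2_def power_mult_distrib)
    moreover have "ell2_norm (matrix_apply D v) = r * ell2_norm (matrix_apply D u)"
      unfolding app using r suminf_mult[OF sq, of "r\<^sup>2"]
      by (simp add: ell2_norm_def power_mult_distrib real_sqrt_mult)
    moreover have "ell2_norm (matrix_apply D u) \<le> N" using le' N by simp
    ultimately show ?thesis using r N by (simp add: r_def mult.commute)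
  qed
  then show "summable (\<lambda>j. D i j * v j)" "matrix_apply D v \<in> ell2"
    "ell2_norm (matrix_apply D v) \<le> real_of_ereal (matrix_norm D) * ell2_norm v" by auto
qed

text \<open>Pairing a row with the square summable sequence \<open>1 / (j + 1)\<close> shows that the row
  has arbitrarily small entries.\<close>

lemma matrix_norm_finite_small_entry:
  assumes fin: "matrix_norm D < \<infinity>" and "0 < e"
  shows "\<exists>m. D i (k + m) < e"
proof (rule ccontr)
  assume "\<not> ?thesis"
  then have ge: "e \<le> D i (k + m)" for m by (meson not_le)
  have inv2: "summable (\<lambda>j. inverse (real (Suc j)) ^ 2)"
    using inverse_power_summable[of 2, where 'a = real] by (subst summable_Suc_iff) (simp add: power_inverse)
  then have v: "(\<lambda>j. inverse (real (Suc j))) \<in> ell2" by (simp add: ell2_def)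
  have "summable (\<lambda>m. D i (m + k) * inverse (real (Suc (m + k))))"
    using summable_ignore_initial_segment[OF matrix_norm_finite(1)[OF fin v]] .
  then have "summable (\<lambda>m. e * inverse (real (Suc (m + k))))"
  proof (rule summable_comparison_test')
    show "norm (e * inverse (real (Suc (m + k)))) \<le> D i (m + k) * inverse (real (Suc (m + k)))" for m
      using ge[of m] \<open>0 < e\<close> by (simp add: add.commute mult_right_mono)
  qed
  then have "summable (\<lambda>m. inverse (real (m + Suc k)))"
    using \<open>0 < e\<close> by (subst (asm) summable_cmult_iff) simp
  then have "summable (\<lambda>m. inverse (real m))"
    by (subst (asm) summable_iff_shift)
  then show False using not_summable_harmonic[where 'a = real] by blast
qed

section \<open>The coordinate filtration and L1 convergence of conditional expectations\<close>

context discrete_process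
begin

text \<open>Generating the sigma-algebra by a single word-valued map into a countable discrete space
  makes every event a union of cylinders and matches the form required by
  \<open>cond_exp_countable_partition\<close>.\<close>

definition past :: "nat \<Rightarrow> 'a measure" where
  "past n = vimage_algebra (space M) (\<lambda>\<omega>. restrict (\<lambda>k. X k \<omega>) {..<n}) (count_space ({..<n} \<rightarrow>\<^sub>E S))"

lemma space_past[simp]: "space (past n) = space M"
  by (simp add: past_def)

lemma sets_past: "sets (past n) = {{\<omega> \<in> space M. restrict (\<lambda>k. X k \<omega>) {..<n} \<in> A} | A. A \<subseteq> {..<n} \<rightarrow>\<^sub>E S}"
proof -
  have "(\<lambda>\<omega>. restrict (\<lambda>k. X k \<omega>) {..<n}) \<in> space M \<rightarrow> space (count_space ({..<n} \<rightarrow>\<^sub>E S))"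
    by (auto simp: X_in_S)
  then have "sets (past n) = {(\<lambda>\<omega>. restrict (\<lambda>k. X k \<omega>) {..<n}) -` A \<inter> space M | A. A \<subseteq> {..<n} \<rightarrow>\<^sub>E S}"
    unfolding past_def by (subst sets_vimage_algebra2) auto
  then show ?thesis by (simp add: vimage_def Int_def conj_commute)
qed

lemma countable_words: "countable ({..<n::nat} \<rightarrow>\<^sub>E S)"
  by (rule countable_PiE) (auto simp: countable_S)

lemma restrict_eq_iff_cylinder:
  "{\<omega>' \<in> space M. restrict (\<lambda>k. X k \<omega>') {..<n} = restrict x {..<n}} = cylinder n x"
  by (auto simp: cylinder_def fun_eq_iff restrict_def)

lemma word_measurable[measurable]:
  "(\<lambda>\<omega>. restrict (\<lambda>k. X k \<omega>) {..<n}) \<in> measurable M (count_space ({..<n} \<rightarrow>\<^sub>E S))"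
proof (subst measurable_count_space_eq_countable[OF countable_words], intro conjI ballI)
  show "(\<lambda>\<omega>. restrict (\<lambda>k. X k \<omega>) {..<n}) \<in> space M \<rightarrow> {..<n} \<rightarrow>\<^sub>E S" by (auto simp: X_in_S)
  fix x assume "x \<in> {..<n} \<rightarrow>\<^sub>E S"
  then have "restrict x {..<n} = x" by auto
  then have "(\<lambda>\<omega>. restrict (\<lambda>k. X k \<omega>) {..<n}) -` {x} \<inter> space M = cylinder n x"
    using restrict_eq_iff_cylinder[of n x] by auto
  then show "(\<lambda>\<omega>. restrict (\<lambda>k. X k \<omega>) {..<n}) -` {x} \<inter> space M \<in> events" by simp
qed

lemma subalgebra_past: "subalgebra M (past n)"
proof -
  have "{\<omega> \<in> space M. restrict (\<lambda>k. X k \<omega>) {..<n} \<in> A} \<in> events" if "A \<subseteq> {..<n} \<rightarrow>\<^sub>E S" for A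
  proof -
    have "(\<lambda>\<omega>. restrict (\<lambda>k. X k \<omega>) {..<n}) -` A \<inter> space M \<in> events"
      using that by (intro measurable_sets[OF word_measurable]) auto
    then show ?thesis by (simp add: vimage_def Int_def conj_commute)
  qed
  then show ?thesis by (auto simp: subalgebra_def sets_past)
qed

lemma finite_measure_subalgebra_past: "finite_measure_subalgebra M (past n)"
  by standard (rule subalgebra_past)

lemma sigma_finite_subalgebra_past: "sigma_finite_subalgebra M (past n)"
  by (rule finite_measure_subalgebra_is_sigma_finite[OF finite_measure_subalgebra_past])

lemma X_measurable_past:
  assumes "i < n" shows "X i \<in> measurable (past n) (count_space S)"
proof (rule measurableI)
  fix A assume "A \<in> sets (count_space S)"
  then have "X i -` A \<inter> space (past n)
      = {\<omega> \<in> space M. restrict (\<lambda>k. X k \<omega>) {..<n} \<in> {x \<in> {..<n} \<rightarrow>\<^sub>E S. x i \<in> A}}"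
    using assms by (auto simp: X_in_S)
  also have "\<dots> \<in> sets (past n)" unfolding sets_past by blast
  finally show "X i -` A \<inter> space (past n) \<in> sets (past n)" .
qed (auto simp: X_in_S)

lemma subalgebra_past_Suc: "subalgebra (past (Suc n)) (past n)"
  unfolding subalgebra_def
proof (intro conjI subsetI)
  fix B assume "B \<in> sets (past n)"
  then obtain A where A: "A \<subseteq> {..<n} \<rightarrow>\<^sub>E S" "B = {\<omega> \<in> space M. restrict (\<lambda>k. X k \<omega>) {..<n} \<in> A}"
    by (auto simp: sets_past)
  have "restrict (restrict (\<lambda>k. X k \<omega>) {..<Suc n}) {..<n} = restrict (\<lambda>k. X k \<omega>) {..<n}" for \<omega>
    by (auto simp: restrict_def)
  then have "B = {\<omega> \<in> space M. restrict (\<lambda>k. X k \<omega>) {..<Suc n} \<in> {x \<in> {..<Suc n} \<rightarrow>\<^sub>E S. restrict x {..<n} \<in> A}}"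
    unfolding A by (auto simp: X_in_S)
  then show "B \<in> sets (past (Suc n))" unfolding sets_past by blast
qed simp

text \<open>This turns an abstract conditional expectation into an average over a cylinder of
  positive probability, the kind of conditioning that \<open>eta\<close> measures.\<close>

lemma cond_exp_past:
  assumes "integrable M h"
  shows "AE \<omega> in M. prob (cylinder n (\<lambda>k. X k \<omega>)) \<noteq> 0 \<and>
    real_cond_exp M (past n) h \<omega> = (\<integral>x. h x \<partial>given n (\<lambda>k. X k \<omega>))"
  using cond_exp_countable_partition[OF countable_words word_measurable assms]
  unfolding past_def restrict_eq_iff_cylinder .

text \<open>Monotonicity of conditional expectation applied to \<open>h\<close> between
  \<open>- \<bar>h\<bar>\<close> and \<open>\<bar>h\<bar>\<close>.\<close>

lemma cond_exp_past_L1: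
  fixes h :: "'a \<Rightarrow> real"
  assumes h: "integrable M h"
  shows "(\<integral>\<omega>. \<bar>real_cond_exp M (past n) h \<omega>\<bar> \<partial>M) \<le> (\<integral>\<omega>. \<bar>h \<omega>\<bar> \<partial>M)"
proof -
  interpret finite_measure_subalgebra M "past n" by (rule finite_measure_subalgebra_past)
  have a: "integrable M (\<lambda>\<omega>. \<bar>h \<omega>\<bar>)" and m: "integrable M (\<lambda>\<omega>. - \<bar>h \<omega>\<bar>)" using h by auto
  have "AE \<omega> in M. real_cond_exp M (past n) h \<omega> \<le> real_cond_exp M (past n) (\<lambda>\<omega>. \<bar>h \<omega>\<bar>) \<omega>"
    by (rule real_cond_exp_mono[OF _ h a]) auto
  moreover have "AE \<omega> in M. real_cond_exp M (past n) (\<lambda>\<omega>. - \<bar>h \<omega>\<bar>) \<omega> \<le> real_cond_exp M (past n) h \<omega>"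
    by (rule real_cond_exp_mono[OF _ m h]) auto
  moreover have "AE \<omega> in M. real_cond_exp M (past n) (\<lambda>\<omega>. - \<bar>h \<omega>\<bar>) \<omega> = - real_cond_exp M (past n) (\<lambda>\<omega>. \<bar>h \<omega>\<bar>) \<omega>"
    using real_cond_exp_cmult[OF a, of "-1"] by simp
  ultimately have "AE \<omega> in M. \<bar>real_cond_exp M (past n) h \<omega>\<bar> \<le> real_cond_exp M (past n) (\<lambda>\<omega>. \<bar>h \<omega>\<bar>) \<omega>"
    by eventually_elim auto
  then have "(\<integral>\<omega>. \<bar>real_cond_exp M (past n) h \<omega>\<bar> \<partial>M) \<le> (\<integral>\<omega>. real_cond_exp M (past n) (\<lambda>\<omega>. \<bar>h \<omega>\<bar>) \<omega> \<partial>M)"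
    using real_cond_exp_int(1)[OF h] real_cond_exp_int(1)[OF a] by (intro integral_mono_AE) auto
  also have "\<dots> = (\<integral>\<omega>. \<bar>h \<omega>\<bar> \<partial>M)" by (rule real_cond_exp_int(2)[OF a])
  finally show ?thesis .
qed

text \<open>The sets approximable to every accuracy form a sigma-algebra that contains the
  conditions on one coordinate. Asking for all large \<open>n\<close>, not just some
  \<open>n\<close>, allows finitely many approximations to be taken at a common
  \<open>n\<close>.\<close>

lemma approx_past_set:
  assumes "A \<in> sets (seq_space S)" "0 < e"
  shows "\<forall>\<^sub>F n in sequentially. \<exists>B \<in> sets (past n).
    prob (sym_diff {\<omega> \<in> space M. (\<lambda>k. X k \<omega>) \<in> A} B) < e"
proof -
  let ?V = "\<lambda>A. {\<omega> \<in> space M. (\<lambda>k. X k \<omega>) \<in> A}"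
  have V: "?V A \<in> events" if "A \<in> sets (seq_space S)" for A
    using measurable_sets[OF future_measurable[of 0] that] by (simp add: vimage_def Int_def conj_commute)
  have pastM: "B \<in> events" if "B \<in> sets (past n)" for B n
    using subalgebra_past[of n] that by (auto simp: subalgebra_def)
  have sets_eq: "sets (seq_space S) = sigma_sets (UNIV \<rightarrow>\<^sub>E S) {{f \<in> UNIV \<rightarrow>\<^sub>E S. f i \<in> A} | i A. A \<subseteq> S}"
    by (simp add: sets_PiM_single)
  have "\<forall>e>0. \<forall>\<^sub>F n in sequentially. \<exists>B \<in> sets (past n). prob (sym_diff (?V A) B) < e"
    using assms(1)[unfolded sets_eq]
  proof (induction rule: sigma_sets.induct)
    case (Basic a)
    then obtain i A where a: "a = {f \<in> UNIV \<rightarrow>\<^sub>E S. f i \<in> A}" "A \<subseteq> S" by blast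
    have "?V a \<in> sets (past n)" if "Suc i \<le> n" for n
    proof -
      have "?V a = X i -` A \<inter> space (past n)" using a by (auto simp: X_in_S)
      then show ?thesis using measurable_sets[OF X_measurable_past[of i n], of A] a that by simp
    qed
    then have "\<forall>\<^sub>F n in sequentially. ?V a \<in> sets (past n)" by (rule eventually_sequentiallyI)
    then have "\<forall>\<^sub>F n in sequentially. \<exists>B \<in> sets (past n). prob (sym_diff (?V a) B) < e" if "0 < e" for e
      by (rule eventually_mono) (use that in \<open>auto intro!: bexI[of _ "?V a"]\<close>)
    then show ?case by blast
  next
    case Empty
    show ?case by (auto intro!: always_eventually bexI[of _ "{}"])
  next
    case (Compl a)
    show ?case
    proof (intro allI impI)
      fix e :: real assume "0 < e"
      with Compl.IH have "\<forall>\<^sub>F n in sequentially. \<exists>B \<in> sets (past n). prob (sym_diff (?V a) B) < e" by blast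
      then show "\<forall>\<^sub>F n in sequentially. \<exists>B \<in> sets (past n). prob (sym_diff (?V ((UNIV \<rightarrow>\<^sub>E S) - a)) B) < e"
      proof (rule eventually_mono, elim bexE)
        fix n B assume B: "B \<in> sets (past n)" "prob (sym_diff (?V a) B) < e"
        have "B \<subseteq> space M" using sets.sets_into_space[OF B(1)] by simp
        moreover have "?V ((UNIV \<rightarrow>\<^sub>E S) - a) = space M - ?V a" by (auto simp: X_in_S)
        moreover have "sym_diff (C - A) (C - B) = sym_diff A B" if "A \<subseteq> C" "B \<subseteq> C" for A B C :: "'a set"
          using that by blast
        ultimately have "sym_diff (?V ((UNIV \<rightarrow>\<^sub>E S) - a)) (space M - B) = sym_diff (?V a) B"
          by simp
        moreover have "space M - B \<in> sets (past n)" using sets.compl_sets[OF B(1)] by simp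
        ultimately show "\<exists>B \<in> sets (past n). prob (sym_diff (?V ((UNIV \<rightarrow>\<^sub>E S) - a)) B) < e"
          using B(2) by (intro bexI[of _ "space M - B"]) simp_all
      qed
    qed
  next
    case (Union a)
    have a: "a j \<in> sets (seq_space S)" for j using Union.hyps unfolding sets_eq .
    define V where "V j = ?V (a j)" for j
    have V_ev: "V j \<in> events" for j unfolding V_def by (rule V[OF a])
    have IH: "\<forall>\<^sub>F n in sequentially. \<exists>B \<in> sets (past n). prob (sym_diff (V j) B) < e" if "0 < e" for e j
      using Union.IH[of j] that unfolding V_def by blast
    have V_UN: "?V (\<Union>j. a j) = (\<Union>j. V j)" by (auto simp: V_def)
    show ?case unfolding V_UN
    proof (intro allI impI)
      fix e :: real assume "0 < e"
      \<comment> \<open>Half of \<open>e\<close> is spent on replacing the countable union by a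
        finite one, the other half on approximating its \<open>m\<close> members.\<close>
      have "(\<lambda>m. prob (\<Union>j<m. V j)) \<longlonglongrightarrow> prob (\<Union>m. \<Union>j<m. V j)"
      proof (rule finite_Lim_measure_incseq)
        show "incseq (\<lambda>m. \<Union>j<m. V j)" by (intro incseq_SucI UN_mono) auto
      qed (use V_ev in auto)
      also have "(\<Union>m. \<Union>j<m. V j) = (\<Union>j. V j)" by blast
      finally obtain m where m: "\<bar>prob (\<Union>j<m. V j) - prob (\<Union>j. V j)\<bar> < e / 2"
        using LIMSEQ_D[of _ _ "e / 2"] \<open>0 < e\<close> by (metis half_gt_zero le_refl real_norm_def)
      \<comment> \<open>\<open>Suc m\<close> in place of \<open>m\<close> keeps the divisor positive
        when the finite union is empty.\<close>
      define d where "d = e / (2 * real (Suc m))"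
      have "0 < d" using \<open>0 < e\<close> by (simp add: d_def)
      have md: "real m * d \<le> e / 2" using \<open>0 < e\<close> by (simp add: d_def field_simps)
      have "\<forall>\<^sub>F n in sequentially. \<forall>j\<in>{..<m}. \<exists>B \<in> sets (past n). prob (sym_diff (V j) B) < d"
        using IH[OF \<open>0 < d\<close>] by (intro eventually_ball_finite) auto
      then show "\<forall>\<^sub>F n in sequentially. \<exists>B \<in> sets (past n). prob (sym_diff (\<Union>j. V j) B) < e"
      proof (rule eventually_mono)
        fix n assume "\<forall>j\<in>{..<m}. \<exists>B \<in> sets (past n). prob (sym_diff (V j) B) < d"
        from this[unfolded Bex_def, THEN bchoice] obtain B where
          B: "\<forall>j\<in>{..<m}. B j \<in> sets (past n) \<and> prob (sym_diff (V j) (B j)) < d" by (elim exE)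
        let ?R = "(\<Union>j. V j) - (\<Union>j<m. V j)" and ?D = "\<Union>j<m. sym_diff (V j) (B j)"
        have Bp: "(\<Union>j<m. B j) \<in> sets (past n)" using B by (intro sets.finite_UN) auto
        have VU: "(\<Union>j. V j) \<in> events" and UM: "(\<Union>j<m. V j) \<in> events" using V_ev by auto
        have D: "sym_diff (V j) (B j) \<in> events" if "j < m" for j
        proof -
          have "B j \<in> events" using B that by (intro pastM[of _ n]) blast
          then show ?thesis using V_ev by (intro sets.Un sets.Diff) auto
        qed
        then have DU: "?D \<in> events" by (intro sets.finite_UN) auto
        have "prob (sym_diff (\<Union>j. V j) (\<Union>j<m. B j)) \<le> prob (?R \<union> ?D)"
        proof (rule finite_measure_mono)
          show "sym_diff (\<Union>j. V j) (\<Union>j<m. B j) \<subseteq> ?R \<union> ?D" by blast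
          show "?R \<union> ?D \<in> events" by (intro sets.Un sets.Diff VU UM DU)
        qed
        also have "\<dots> \<le> prob ?R + prob ?D"
          by (intro measure_Un_le sets.Diff VU UM DU)
        also have "prob ?R = prob (\<Union>j. V j) - prob (\<Union>j<m. V j)"
          by (intro finite_measure_Diff VU UM) blast
        also have "prob ?D \<le> (\<Sum>j<m. prob (sym_diff (V j) (B j)))"
          using D by (intro measure_UNION_le) auto
        also have "(\<Sum>j<m. prob (sym_diff (V j) (B j))) \<le> (\<Sum>j<m. d)"
          using B by (intro sum_mono less_imp_le) blast
        also have "\<dots> = real m * d" by simp
        finally have "prob (sym_diff (\<Union>j. V j) (\<Union>j<m. B j)) < e" using m md by linarith
        with Bp show "\<exists>B \<in> sets (past n). prob (sym_diff (\<Union>j. V j) B) < e" by (rule bexI[rotated])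
      qed
    qed
  qed
  then show ?thesis using \<open>0 < e\<close> by blast
qed

lemma seq_measurable[measurable]: "(\<lambda>\<omega> k. X k \<omega>) \<in> measurable M (seq_space S)"
  using future_measurable[of 0] by simp

text \<open>Density in L1: induction over indicators, sums and dominated limits, carried out for the
  law of the process on the sequence space.\<close>

lemma approx_past_integrable:
  fixes f :: "(nat \<Rightarrow> 'b) \<Rightarrow> real"
  assumes "integrable (distr M (seq_space S) (\<lambda>\<omega> k. X k \<omega>)) f" "0 < e"
  shows "\<forall>\<^sub>F n in sequentially. \<exists>\<psi> \<in> borel_measurable (past n).
    integrable M \<psi> \<and> (\<integral>\<omega>. \<bar>f (\<lambda>k. X k \<omega>) - \<psi> \<omega>\<bar> \<partial>M) < e"
proof -
  let ?Q = "distr M (seq_space S) (\<lambda>\<omega> k. X k \<omega>)"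
  have comp: "integrable M (\<lambda>\<omega>. h (\<lambda>k. X k \<omega>))" if "integrable ?Q h" for h :: "(nat \<Rightarrow> 'b) \<Rightarrow> real"
    using integrable_distr[OF seq_measurable that] .
  have "\<forall>e>0. \<forall>\<^sub>F n in sequentially. \<exists>\<psi> \<in> borel_measurable (past n).
    integrable M \<psi> \<and> (\<integral>\<omega>. \<bar>f (\<lambda>k. X k \<omega>) - \<psi> \<omega>\<bar> \<partial>M) < e"
    using assms(1)
  proof (induction rule: integrable_induct)
    case (base A c)
    then have A: "A \<in> sets (seq_space S)" by simp
    let ?V = "{\<omega> \<in> space M. (\<lambda>k. X k \<omega>) \<in> A}"
    have V: "?V \<in> events"
      using measurable_sets[OF seq_measurable A] by (simp add: vimage_def Int_def conj_commute)
    show ?case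
    proof (intro allI impI)
      fix e :: real assume "0 < e"
      \<comment> \<open>The added 1 covers \<open>c = 0\<close>.\<close>
      then have "0 < e / (\<bar>c\<bar> + 1)" by (simp add: add_nonneg_pos)
      from approx_past_set[OF A this]
      show "\<forall>\<^sub>F n in sequentially. \<exists>\<psi> \<in> borel_measurable (past n).
        integrable M \<psi> \<and> (\<integral>\<omega>. \<bar>indicator A (\<lambda>k. X k \<omega>) *\<^sub>R c - \<psi> \<omega>\<bar> \<partial>M) < e"
      proof (rule eventually_mono, elim bexE)
        fix n B assume B: "B \<in> sets (past n)" and lt: "prob (sym_diff ?V B) < e / (\<bar>c\<bar> + 1)"
        have BM: "B \<in> events" using subalgebra_past[of n] B by (auto simp: subalgebra_def)
        have D: "sym_diff ?V B \<in> events" using V BM by auto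
        let ?\<psi> = "\<lambda>\<omega>. indicator B \<omega> * c"
        have "(\<integral>\<omega>. \<bar>indicator A (\<lambda>k. X k \<omega>) *\<^sub>R c - ?\<psi> \<omega>\<bar> \<partial>M) = (\<integral>\<omega>. indicator (sym_diff ?V B) \<omega> * \<bar>c\<bar> \<partial>M)"
          by (intro Bochner_Integration.integral_cong) (auto simp: indicator_def)
        also have "\<dots> = prob (sym_diff ?V B) * \<bar>c\<bar>" using D by simp
        also have "\<dots> \<le> prob (sym_diff ?V B) * (\<bar>c\<bar> + 1)" by (intro mult_left_mono) auto
        also have "\<dots> < e" using lt by (simp add: pos_less_divide_eq add_nonneg_pos)
        finally have "(\<integral>\<omega>. \<bar>indicator A (\<lambda>k. X k \<omega>) *\<^sub>R c - ?\<psi> \<omega>\<bar> \<partial>M) < e" .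
        moreover have "?\<psi> \<in> borel_measurable (past n)" using B by measurable
        moreover have "integrable M ?\<psi>" using BM by (simp add: integrable_indicator_iff emeasure_eq_measure)
        ultimately show "\<exists>\<psi> \<in> borel_measurable (past n).
          integrable M \<psi> \<and> (\<integral>\<omega>. \<bar>indicator A (\<lambda>k. X k \<omega>) *\<^sub>R c - \<psi> \<omega>\<bar> \<partial>M) < e" by blast
      qed
    qed
  next
    case (add f g)
    show ?case
    proof (intro allI impI)
      fix e :: real assume "0 < e"
      then have "0 < e / 2" by simp
      with add.IH have
        "\<forall>\<^sub>F n in sequentially. \<exists>\<psi> \<in> borel_measurable (past n).
          integrable M \<psi> \<and> (\<integral>\<omega>. \<bar>f (\<lambda>k. X k \<omega>) - \<psi> \<omega>\<bar> \<partial>M) < e / 2"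
        "\<forall>\<^sub>F n in sequentially. \<exists>\<psi> \<in> borel_measurable (past n).
          integrable M \<psi> \<and> (\<integral>\<omega>. \<bar>g (\<lambda>k. X k \<omega>) - \<psi> \<omega>\<bar> \<partial>M) < e / 2" by blast+
      then show "\<forall>\<^sub>F n in sequentially. \<exists>\<psi> \<in> borel_measurable (past n).
        integrable M \<psi> \<and> (\<integral>\<omega>. \<bar>f (\<lambda>k. X k \<omega>) + g (\<lambda>k. X k \<omega>) - \<psi> \<omega>\<bar> \<partial>M) < e"
      proof eventually_elim
        case (elim n)
        then obtain p q where
          [measurable]: "p \<in> borel_measurable (past n)" "q \<in> borel_measurable (past n)"
          and pq: "integrable M p" "integrable M q"
          and lt: "(\<integral>\<omega>. \<bar>f (\<lambda>k. X k \<omega>) - p \<omega>\<bar> \<partial>M) < e / 2" "(\<integral>\<omega>. \<bar>g (\<lambda>k. X k \<omega>) - q \<omega>\<bar> \<partial>M) < e / 2"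
          by blast
        have "(\<integral>\<omega>. \<bar>f (\<lambda>k. X k \<omega>) + g (\<lambda>k. X k \<omega>) - (p \<omega> + q \<omega>)\<bar> \<partial>M)
          \<le> (\<integral>\<omega>. \<bar>f (\<lambda>k. X k \<omega>) - p \<omega>\<bar> + \<bar>g (\<lambda>k. X k \<omega>) - q \<omega>\<bar> \<partial>M)"
          using comp[OF add.hyps(1)] comp[OF add.hyps(2)] pq by (intro integral_mono) auto
        also have "\<dots> = (\<integral>\<omega>. \<bar>f (\<lambda>k. X k \<omega>) - p \<omega>\<bar> \<partial>M) + (\<integral>\<omega>. \<bar>g (\<lambda>k. X k \<omega>) - q \<omega>\<bar> \<partial>M)"
          using comp[OF add.hyps(1)] comp[OF add.hyps(2)] pq by (intro Bochner_Integration.integral_add) auto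
        finally have "(\<integral>\<omega>. \<bar>f (\<lambda>k. X k \<omega>) + g (\<lambda>k. X k \<omega>) - (p \<omega> + q \<omega>)\<bar> \<partial>M) < e" using lt by linarith
        moreover have "(\<lambda>\<omega>. p \<omega> + q \<omega>) \<in> borel_measurable (past n)" by measurable
        moreover have "integrable M (\<lambda>\<omega>. p \<omega> + q \<omega>)" using pq by simp
        ultimately show ?case by blast
      qed
    qed
  next
    case (lim f s)
    show ?case
    proof (intro allI impI)
      fix e :: real assume "0 < e"
      have XQ: "(\<lambda>k. X k \<omega>) \<in> space ?Q" if "\<omega> \<in> space M" for \<omega>
        using measurable_space[OF seq_measurable that] by simp
      have fi: "integrable M (\<lambda>\<omega>. f (\<lambda>k. X k \<omega>))" and si: "integrable M (\<lambda>\<omega>. s i (\<lambda>k. X k \<omega>))" for i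
        using comp lim.hyps by blast+
      have "(\<lambda>i. \<integral>\<omega>. \<bar>f (\<lambda>k. X k \<omega>) - s i (\<lambda>k. X k \<omega>)\<bar> \<partial>M) \<longlonglongrightarrow> (\<integral>\<omega>. 0 \<partial>M)"
      \<comment> \<open>The approximants of the induction rule satisfy
        \<open>\<bar>s i\<bar> \<le> 2 * \<bar>f\<bar>\<close>, so 3 dominates the
        difference.\<close>
      proof (rule integral_dominated_convergence[where w = "\<lambda>\<omega>. 3 * \<bar>f (\<lambda>k. X k \<omega>)\<bar>"])
        show "integrable M (\<lambda>\<omega>. 3 * \<bar>f (\<lambda>k. X k \<omega>)\<bar>)" using fi by simp
        show "(\<lambda>\<omega>. \<bar>f (\<lambda>k. X k \<omega>) - s i (\<lambda>k. X k \<omega>)\<bar>) \<in> borel_measurable M" for i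
          using fi si[of i] by (intro borel_measurable_integrable integrable_abs Bochner_Integration.integrable_diff)
        show "AE \<omega> in M. (\<lambda>i. \<bar>f (\<lambda>k. X k \<omega>) - s i (\<lambda>k. X k \<omega>)\<bar>) \<longlonglongrightarrow> 0"
        proof (rule AE_I2)
          fix \<omega> assume "\<omega> \<in> space M"
          then have "(\<lambda>i. f (\<lambda>k. X k \<omega>) - s i (\<lambda>k. X k \<omega>)) \<longlonglongrightarrow> f (\<lambda>k. X k \<omega>) - f (\<lambda>k. X k \<omega>)"
            using lim.hyps(2)[OF XQ] by (intro tendsto_diff tendsto_const)
          then show "(\<lambda>i. \<bar>f (\<lambda>k. X k \<omega>) - s i (\<lambda>k. X k \<omega>)\<bar>) \<longlonglongrightarrow> 0"
            using tendsto_rabs_zero by auto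
        qed
        show "AE \<omega> in M. norm \<bar>f (\<lambda>k. X k \<omega>) - s i (\<lambda>k. X k \<omega>)\<bar> \<le> 3 * \<bar>f (\<lambda>k. X k \<omega>)\<bar>" for i
        proof (rule AE_I2)
          fix \<omega> assume "\<omega> \<in> space M"
          from lim.hyps(3)[OF XQ[OF this], of i]
          show "norm \<bar>f (\<lambda>k. X k \<omega>) - s i (\<lambda>k. X k \<omega>)\<bar> \<le> 3 * \<bar>f (\<lambda>k. X k \<omega>)\<bar>" by simp
        qed
      qed simp
      then have "\<forall>\<^sub>F i in sequentially. (\<integral>\<omega>. \<bar>f (\<lambda>k. X k \<omega>) - s i (\<lambda>k. X k \<omega>)\<bar> \<partial>M) < e / 2"
        using \<open>0 < e\<close> by (intro order_tendstoD(2)) auto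
      then obtain i where i: "(\<integral>\<omega>. \<bar>f (\<lambda>k. X k \<omega>) - s i (\<lambda>k. X k \<omega>)\<bar> \<partial>M) < e / 2"
        by (auto simp: eventually_sequentially)
      have "0 < e / 2" using \<open>0 < e\<close> by simp
      with lim.IH[of i] have "\<forall>\<^sub>F n in sequentially. \<exists>\<psi> \<in> borel_measurable (past n).
          integrable M \<psi> \<and> (\<integral>\<omega>. \<bar>s i (\<lambda>k. X k \<omega>) - \<psi> \<omega>\<bar> \<partial>M) < e / 2" by blast
      then show "\<forall>\<^sub>F n in sequentially. \<exists>\<psi> \<in> borel_measurable (past n).
        integrable M \<psi> \<and> (\<integral>\<omega>. \<bar>f (\<lambda>k. X k \<omega>) - \<psi> \<omega>\<bar> \<partial>M) < e"
      proof (rule eventually_mono, elim bexE conjE)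
        fix n p assume p: "p \<in> borel_measurable (past n)" "integrable M p"
          and lt: "(\<integral>\<omega>. \<bar>s i (\<lambda>k. X k \<omega>) - p \<omega>\<bar> \<partial>M) < e / 2"
        have "(\<integral>\<omega>. \<bar>f (\<lambda>k. X k \<omega>) - p \<omega>\<bar> \<partial>M)
          \<le> (\<integral>\<omega>. \<bar>f (\<lambda>k. X k \<omega>) - s i (\<lambda>k. X k \<omega>)\<bar> + \<bar>s i (\<lambda>k. X k \<omega>) - p \<omega>\<bar> \<partial>M)"
          using fi si[of i] p by (intro integral_mono) auto
        also have "\<dots> = (\<integral>\<omega>. \<bar>f (\<lambda>k. X k \<omega>) - s i (\<lambda>k. X k \<omega>)\<bar> \<partial>M) + (\<integral>\<omega>. \<bar>s i (\<lambda>k. X k \<omega>) - p \<omega>\<bar> \<partial>M)"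
          using fi si[of i] p by (intro Bochner_Integration.integral_add) auto
        finally have "(\<integral>\<omega>. \<bar>f (\<lambda>k. X k \<omega>) - p \<omega>\<bar> \<partial>M) < e" using i lt by linarith
        with p show "\<exists>\<psi> \<in> borel_measurable (past n).
          integrable M \<psi> \<and> (\<integral>\<omega>. \<bar>f (\<lambda>k. X k \<omega>) - \<psi> \<omega>\<bar> \<partial>M) < e" by blast
      qed
    qed
  qed
  then show ?thesis using \<open>0 < e\<close> by blast
qed

text \<open>The L1 form of Levy's upward theorem, obtained from density: conditional expectation is
  an L1 contraction and fixes any integrable \<open>past n\<close>-measurable \<open>p\<close>, so
  the error is at most twice the L1 distance from \<open>f\<close> to \<open>p\<close>.\<close>

lemma cond_exp_past_tendsto_L1:
  fixes f :: "(nat \<Rightarrow> 'b) \<Rightarrow> real"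
  assumes [measurable]: "f \<in> borel_measurable (seq_space S)" and f: "integrable M (\<lambda>\<omega>. f (\<lambda>k. X k \<omega>))"
  shows "(\<lambda>n. \<integral>\<omega>. \<bar>f (\<lambda>k. X k \<omega>) - real_cond_exp M (past n) (\<lambda>\<omega>. f (\<lambda>k. X k \<omega>)) \<omega>\<bar> \<partial>M) \<longlonglongrightarrow> 0"
proof (rule order_tendstoI)
  fix e :: real assume "0 < e"
  then have "0 < e / 2" by simp
  have "integrable (distr M (seq_space S) (\<lambda>\<omega> k. X k \<omega>)) f"
    using f by (subst integrable_distr_eq) auto
  from approx_past_integrable[OF this \<open>0 < e / 2\<close>]
  show "\<forall>\<^sub>F n in sequentially. (\<integral>\<omega>. \<bar>f (\<lambda>k. X k \<omega>) - real_cond_exp M (past n) (\<lambda>\<omega>. f (\<lambda>k. X k \<omega>)) \<omega>\<bar> \<partial>M) < e"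
  proof (rule eventually_mono, elim bexE conjE)
    fix n p assume p: "p \<in> borel_measurable (past n)" "integrable M p"
      and lt: "(\<integral>\<omega>. \<bar>f (\<lambda>k. X k \<omega>) - p \<omega>\<bar> \<partial>M) < e / 2"
    interpret finite_measure_subalgebra M "past n" by (rule finite_measure_subalgebra_past)
    let ?f = "\<lambda>\<omega>. f (\<lambda>k. X k \<omega>)"
    let ?C = "real_cond_exp M (past n)"
    have d: "integrable M (\<lambda>\<omega>. ?f \<omega> - p \<omega>)" using f p by simp
    have ic: "integrable M (?C ?f)" "integrable M (?C (\<lambda>\<omega>. ?f \<omega> - p \<omega>))"
      using real_cond_exp_int(1) f d by blast+
    have "AE \<omega> in M. ?C (\<lambda>\<omega>. ?f \<omega> - p \<omega>) \<omega> = ?C ?f \<omega> - ?C p \<omega>"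
      by (rule real_cond_exp_diff[OF f p(2)])
    moreover have "AE \<omega> in M. ?C p \<omega> = p \<omega>" by (rule real_cond_exp_F_meas[OF p(2,1)])
    ultimately have "AE \<omega> in M. \<bar>?f \<omega> - ?C ?f \<omega>\<bar> \<le> \<bar>?f \<omega> - p \<omega>\<bar> + \<bar>?C (\<lambda>\<omega>. ?f \<omega> - p \<omega>) \<omega>\<bar>"
      by eventually_elim linarith
    then have "(\<integral>\<omega>. \<bar>?f \<omega> - ?C ?f \<omega>\<bar> \<partial>M) \<le> (\<integral>\<omega>. \<bar>?f \<omega> - p \<omega>\<bar> + \<bar>?C (\<lambda>\<omega>. ?f \<omega> - p \<omega>) \<omega>\<bar> \<partial>M)"
      using f d ic by (intro integral_mono_AE) auto
    also have "\<dots> = (\<integral>\<omega>. \<bar>?f \<omega> - p \<omega>\<bar> \<partial>M) + (\<integral>\<omega>. \<bar>?C (\<lambda>\<omega>. ?f \<omega> - p \<omega>) \<omega>\<bar> \<partial>M)"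
      using d ic by (intro Bochner_Integration.integral_add) auto
    finally show "(\<integral>\<omega>. \<bar>?f \<omega> - ?C ?f \<omega>\<bar> \<partial>M) < e"
      using lt cond_exp_past_L1[OF d, of n] by linarith
  qed
qed (auto intro!: always_eventually intro: less_le_trans[OF _ integral_nonneg_AE])

section \<open>Oscillation of the martingale and moment generating functions\<close>

text \<open>\<open>integral_diff_le_mixing\<close> holds for every \<open>m\<close>, so one
  \<open>m\<close> with a small entry in row \<open>i\<close> suffices; convergence of the row to 0
  is not asked for. The finite sum is dominated by the full row sum because all terms are
  nonnegative.\<close>

lemma integral_diff_le_matrix_apply:
  assumes fin: "matrix_norm (mixing_matrix M S X) < \<infinity>"
    and \<phi>: "\<phi> \<in> borel_measurable (seq_space S)"
    and bd: "\<And>y. \<bar>\<phi> y\<bar> \<le> K"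
    and lip: "c_lipschitz S c \<phi>"
    and c: "\<And>i. 0 \<le> c i" "c \<in> ell2"
    and x: "x \<in> {..i} \<rightarrow>\<^sub>E S" "x' \<in> {..i} \<rightarrow>\<^sub>E S" "differ_only_at i x x'"
    and pos: "prob (cylinder (Suc i) x) \<noteq> 0" "prob (cylinder (Suc i) x') \<noteq> 0"
  shows "\<bar>(\<integral>\<omega>. \<phi> (\<lambda>k. X k \<omega>) \<partial>given (Suc i) x) - (\<integral>\<omega>. \<phi> (\<lambda>k. X k \<omega>) \<partial>given (Suc i) x')\<bar>
    \<le> 2 * matrix_apply (mixing_matrix M S X) c i"
proof (rule field_le_epsilon)
  fix e :: real assume "0 < e"
  let ?D = "mixing_matrix M S X"
  have K: "0 \<le> K" using bd[of undefined] by linarith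
  \<comment> \<open>The added 1 keeps the divisor positive when \<open>K = 0\<close>.\<close>
  then have "0 < e / (2 * K + 1)" using \<open>0 < e\<close> by simp
  from matrix_norm_finite_small_entry[OF fin this, of i "Suc i"] obtain m where
    m: "eta M S X i (Suc i + m) < e / (2 * K + 1)" by (auto simp: mixing_matrix_def)
  have "2 * K * eta M S X i (Suc i + m) \<le> (2 * K + 1) * eta M S X i (Suc i + m)"
    using eta_nonneg by (intro mult_right_mono) auto
  also have "\<dots> \<le> e" using m K by (simp add: field_simps)
  finally have rest: "2 * K * eta M S X i (Suc i + m) \<le> e" .
  have nonneg: "0 \<le> ?D i j * c j" for j using c(1)[of j] eta_nonneg by (simp add: mixing_matrix_def)
  \<comment> \<open>The diagonal entry 1 of the mixing matrix accounts for \<open>c i\<close>;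
    entries left of the diagonal vanish.\<close>
  have "c i + (\<Sum>j = Suc i..<Suc i + m. eta M S X i j * c j) = (\<Sum>j = i..<Suc i + m. ?D i j * c j)"
    by (subst sum.atLeast_Suc_lessThan) (auto simp: mixing_matrix_def intro!: sum.cong)
  also have "\<dots> \<le> matrix_apply ?D c i"
    unfolding matrix_apply_def using matrix_norm_finite(1)[OF fin c(2)] nonneg by (intro sum_le_suminf) auto
  finally have "c i + (\<Sum>j = Suc i..<Suc i + m. eta M S X i j * c j) \<le> matrix_apply ?D c i" .
  then show "\<bar>(\<integral>\<omega>. \<phi> (\<lambda>k. X k \<omega>) \<partial>given (Suc i) x) - (\<integral>\<omega>. \<phi> (\<lambda>k. X k \<omega>) \<partial>given (Suc i) x')\<bar>
    \<le> 2 * matrix_apply ?D c i + e"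
    using integral_diff_le_mixing[OF \<phi> bd lip c(1) x pos, of m] rest c(1)[of i] by linarith
qed

lemma cond_exp_past_bounded:
  fixes f :: "'a \<Rightarrow> real"
  assumes [measurable]: "f \<in> borel_measurable M" and bd: "\<And>\<omega>. \<bar>f \<omega>\<bar> \<le> K"
  shows "AE \<omega> in M. \<bar>real_cond_exp M (past n) f \<omega>\<bar> \<le> K"
proof -
  have f: "integrable M f" using bd by (intro integrable_const_bound[where B = K]) auto
  from cond_exp_past[OF f, of n] show ?thesis
  proof (rule AE_mp[OF _ AE_I2], intro impI, elim conjE)
    fix \<omega> assume pos: "prob (cylinder n (\<lambda>k. X k \<omega>)) \<noteq> 0"
      and eq: "real_cond_exp M (past n) f \<omega> = (\<integral>x. f x \<partial>given n (\<lambda>k. X k \<omega>))"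
    interpret N: prob_space "given n (\<lambda>k. X k \<omega>)" by (rule prob_space_given[OF pos])
    have fN: "integrable (given n (\<lambda>k. X k \<omega>)) (\<lambda>x. \<bar>f x\<bar>)"
      using bd by (intro N.integrable_const_bound[where B = K]) auto
    have "\<bar>\<integral>x. f x \<partial>given n (\<lambda>k. X k \<omega>)\<bar> \<le> (\<integral>x. \<bar>f x\<bar> \<partial>given n (\<lambda>k. X k \<omega>))"
      by (rule integral_abs_bound)
    also have "\<dots> \<le> K" using bd by (intro N.integral_le_const fN) auto
    finally show "\<bar>real_cond_exp M (past n) f \<omega>\<bar> \<le> K" unfolding eq .
  qed
qed

lemma integrable_exp_bounded:
  fixes g :: "'a \<Rightarrow> real"
  assumes [measurable]: "g \<in> borel_measurable M" and bd: "AE \<omega> in M. \<bar>g \<omega>\<bar> \<le> K" and s: "0 \<le> s"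
  shows "integrable M (\<lambda>\<omega>. exp (s * g \<omega>))"
  using bd by (intro integrable_const_bound[where B = "exp (s * K)"])
    (auto elim!: eventually_mono intro: mult_left_mono[OF _ s])

text \<open>Conditioned on the first \<open>n\<close> coordinates, the next conditional expectation takes values in an
  interval of length \<open>2 d\<close>, so Hoeffding's lemma applies.\<close>

lemma mgf_cond_exp_step:
  fixes f :: "'a \<Rightarrow> real"
  assumes f[measurable]: "f \<in> borel_measurable M" and bd: "\<And>\<omega>. \<bar>f \<omega>\<bar> \<le> K" and s: "0 < s"
    and osc: "\<And>x x'. \<lbrakk>x \<in> {..n} \<rightarrow>\<^sub>E S; x' \<in> {..n} \<rightarrow>\<^sub>E S; differ_only_at n x x';
      prob (cylinder (Suc n) x) \<noteq> 0; prob (cylinder (Suc n) x') \<noteq> 0\<rbrakk> \<Longrightarrow>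
      \<bar>(\<integral>\<omega>. f \<omega> \<partial>given (Suc n) x) - (\<integral>\<omega>. f \<omega> \<partial>given (Suc n) x')\<bar> \<le> 2 * d"
    and d: "0 \<le> d"
  shows "(\<integral>\<omega>. exp (s * real_cond_exp M (past (Suc n)) f \<omega>) \<partial>M)
    \<le> exp (s\<^sup>2 * d\<^sup>2 / 2) * (\<integral>\<omega>. exp (s * real_cond_exp M (past n) f \<omega>) \<partial>M)"
proof -
  interpret F: sigma_finite_subalgebra M "past n" by (rule sigma_finite_subalgebra_past)
  interpret G: sigma_finite_subalgebra M "past (Suc n)" by (rule sigma_finite_subalgebra_past)
  define g where "g = real_cond_exp M (past n) f"
  define g' where "g' = real_cond_exp M (past (Suc n)) f"
  have [measurable]: "g \<in> borel_measurable M" "g' \<in> borel_measurable M" by (simp_all add: g_def g'_def)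
  have fi: "integrable M f" using bd by (intro integrable_const_bound[where B = K]) auto
  have g_bd: "AE \<omega> in M. \<bar>g \<omega>\<bar> \<le> K" and g'_bd: "AE \<omega> in M. \<bar>g' \<omega>\<bar> \<le> K"
    unfolding g_def g'_def by (rule cond_exp_past_bounded[OF f bd])+
  have g'i: "integrable M g'" unfolding g'_def by (rule G.real_cond_exp_int(1)[OF fi])
  have eg: "integrable M (\<lambda>\<omega>. exp (s * g \<omega>))" and eg': "integrable M (\<lambda>\<omega>. exp (s * g' \<omega>))"
    using s g_bd g'_bd by (auto intro!: integrable_exp_bounded)
  have tower: "AE \<omega> in M. real_cond_exp M (past n) g' \<omega> = g \<omega>"
    unfolding g_def g'_def
    by (rule F.real_cond_exp_nested_subalg[OF subalgebra_past subalgebra_past_Suc fi])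
  have "AE \<omega> in M. real_cond_exp M (past n) (\<lambda>\<omega>. exp (s * g' \<omega>)) \<omega> \<le> exp (s\<^sup>2 * d\<^sup>2 / 2) * exp (s * g \<omega>)"
    using cond_exp_past[OF g'i, of n] cond_exp_past[OF eg', of n] tower
  proof eventually_elim
    case (elim \<omega>)
    let ?N = "given n (\<lambda>k. X k \<omega>)"
    have pos: "prob (cylinder n (\<lambda>k. X k \<omega>)) \<noteq> 0" using elim by blast
    interpret N: prob_space ?N by (rule prob_space_given[OF pos])
    \<comment> \<open>By the tower property \<open>g \<omega>\<close> is the mean of
      \<open>g'\<close> over the atom, so it is the centre in Hoeffding's lemma.\<close>
    have mean: "(\<integral>x. g' x \<partial>?N) = g \<omega>" using elim by simp
    \<comment> \<open>Off a null part of the atom, \<open>g'\<close> is an average over a cylinder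
      of length \<open>n + 1\<close>. As the first \<open>n\<close> letters are fixed on the atom,
      its value depends only on the letter at \<open>n\<close>.\<close>
    define A where "A = {\<omega>' \<in> cylinder n (\<lambda>k. X k \<omega>). prob (cylinder (Suc n) (\<lambda>k. X k \<omega>')) \<noteq> 0 \<and>
      g' \<omega>' = (\<integral>x. f x \<partial>given (Suc n) (\<lambda>k. X k \<omega>'))}"
    have AE_A: "AE \<omega>' in ?N. \<omega>' \<in> A"
      using cond_exp_past[OF fi, of "Suc n"]
      by (intro AE_uniform_measureI) (auto simp: A_def g'_def)
    then obtain \<omega>\<^sub>0 where \<omega>\<^sub>0: "\<omega>\<^sub>0 \<in> A" using N.AE_False by (metis (mono_tags, lifting) eventually_mono)
    have diff: "\<bar>g' u - g' v\<bar> \<le> 2 * d" if uv: "u \<in> A" "v \<in> A" for u v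
    proof -
      have sp: "u \<in> space M" "v \<in> space M" using uv by (auto simp: A_def cylinder_def)
      have agree: "X k u = X k v" if "k < n" for k using uv that by (simp add: A_def cylinder_def)
      define x where "x w = restrict (\<lambda>k. X k w) {..n}" for w
      have cyl: "cylinder (Suc n) (\<lambda>k. X k w) = cylinder (Suc n) (x w)" for w
        by (auto simp: cylinder_def x_def)
      have val: "g' w = (\<integral>z. f z \<partial>given (Suc n) (x w)) \<and> prob (cylinder (Suc n) (x w)) \<noteq> 0" if "w \<in> A" for w
        using that by (simp add: A_def cyl)
      have xS: "x u \<in> {..n} \<rightarrow>\<^sub>E S" "x v \<in> {..n} \<rightarrow>\<^sub>E S" using sp by (auto simp: x_def X_in_S)
      have xeq: "x u k = x v k" if "k \<noteq> n" for k using that agree[of k] by (cases "k < n") (auto simp: x_def)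
      show ?thesis
      \<comment> \<open>Equal letters mean the same cylinder, hence equal values; \<open>osc\<close>
        covers only words that do differ at \<open>n\<close>.\<close>
      proof (cases "x u n = x v n")
        case True
        have "x u = x v"
        proof
          show "x u k = x v k" for k using True xeq[of k] by (cases "k = n") auto
        qed
        then have "g' u = g' v" using val[OF uv(1)] val[OF uv(2)] by simp
        then show ?thesis using d by simp
      next
        case False
        then have "differ_only_at n (x u) (x v)" using xeq by (simp add: differ_only_at_def)
        from osc[OF xS this] show ?thesis using val[OF uv(1)] val[OF uv(2)] by simp
      qed
    qed
    have bdd: "bdd_below (g' ` A)"
    proof (rule bdd_belowI2)
      show "g' \<omega>\<^sub>0 - 2 * d \<le> g' u" if "u \<in> A" for u using diff[OF \<omega>\<^sub>0 that] by linarith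
    qed
    define a where "a = (INF u\<in>A. g' u)"
    have range: "g' u \<in> {a..a + 2 * d}" if "u \<in> A" for u
    proof -
      have "a \<le> g' u" unfolding a_def by (rule cINF_lower[OF bdd that])
      moreover have "g' u - 2 * d \<le> a" unfolding a_def
      proof (rule cINF_greatest)
        show "g' u - 2 * d \<le> g' v" if "v \<in> A" for v using diff[OF \<open>u \<in> A\<close> that] by linarith
      qed (use \<omega>\<^sub>0 in auto)
      ultimately show ?thesis by simp
    qed
    interpret H: interval_bounded_random_variable ?N g' a "a + 2 * d"
    proof
      show "AE x in ?N. g' x \<in> {a..a + 2 * d}" using AE_A by eventually_elim (rule range)
    qed simp
    \<comment> \<open>For an interval of length \<open>2 * d\<close>, the constant 1/8 of
      Hoeffding's lemma becomes 1/2 in front of \<open>d\<^sup>2\<close>.\<close>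
    have "(\<integral>\<^sup>+x. exp (s * (g' x - g \<omega>)) \<partial>?N) \<le> ennreal (exp (s\<^sup>2 * (2 * d)\<^sup>2 / 8))"
      using H.Hoeffdings_lemma_nn_integral[OF s] by (simp add: mean)
    moreover have i: "integrable ?N (\<lambda>x. exp (s * (g' x - g \<omega>)))"
    proof (rule N.integrable_const_bound)
      show "AE x in ?N. norm (exp (s * (g' x - g \<omega>))) \<le> exp (s * (a + 2 * d - g \<omega>))"
        using AE_A by eventually_elim (use s range in \<open>auto intro!: mult_left_mono\<close>)
    qed simp
    ultimately have "(\<integral>x. exp (s * (g' x - g \<omega>)) \<partial>?N) \<le> exp (s\<^sup>2 * d\<^sup>2 / 2)"
      by (subst (asm) nn_integral_eq_integral) (auto simp: power_mult_distrib mult.commute)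
    then have "(\<integral>x. exp (s * (g' x - g \<omega>)) \<partial>?N) * exp (s * g \<omega>) \<le> exp (s\<^sup>2 * d\<^sup>2 / 2) * exp (s * g \<omega>)"
      by (intro mult_right_mono) auto
    also have "(\<integral>x. exp (s * (g' x - g \<omega>)) \<partial>?N) * exp (s * g \<omega>) = (\<integral>x. exp (s * g' x) \<partial>?N)"
      by (subst integral_mult_left_zero[symmetric]) (simp add: algebra_simps flip: exp_add)
    finally show ?case using elim by simp
  qed
  then have "(\<integral>\<omega>. real_cond_exp M (past n) (\<lambda>\<omega>. exp (s * g' \<omega>)) \<omega> \<partial>M)
      \<le> (\<integral>\<omega>. exp (s\<^sup>2 * d\<^sup>2 / 2) * exp (s * g \<omega>) \<partial>M)"
    using F.real_cond_exp_int(1)[OF eg'] eg by (intro integral_mono_AE) auto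
  then show ?thesis
    using F.real_cond_exp_int(2)[OF eg'] by (simp add: g_def g'_def)
qed

text \<open>Iterating \<open>mgf_cond_exp_step\<close> down to the trivial \<open>past 0\<close>
  bounds the exponential moment of each conditional expectation uniformly. For bounded
  \<open>\<phi>\<close>, L1 convergence then transfers the bound to \<open>\<phi>\<close> itself,
  and \<open>K\<close> disappears in the limit.\<close>

lemma mgf_bounded:
  fixes \<phi> :: "(nat \<Rightarrow> 'b) \<Rightarrow> real"
  assumes \<phi>[measurable]: "\<phi> \<in> borel_measurable (seq_space S)"
    and bd: "\<And>y. \<bar>\<phi> y\<bar> \<le> K" and s: "0 < s"
    and osc: "\<And>n x x'. \<lbrakk>x \<in> {..n} \<rightarrow>\<^sub>E S; x' \<in> {..n} \<rightarrow>\<^sub>E S; differ_only_at n x x';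
      prob (cylinder (Suc n) x) \<noteq> 0; prob (cylinder (Suc n) x') \<noteq> 0\<rbrakk> \<Longrightarrow>
      \<bar>(\<integral>\<omega>. \<phi> (\<lambda>k. X k \<omega>) \<partial>given (Suc n) x) - (\<integral>\<omega>. \<phi> (\<lambda>k. X k \<omega>) \<partial>given (Suc n) x')\<bar> \<le> 2 * d n"
    and d: "\<And>n. 0 \<le> d n" "\<And>n. (\<Sum>i<n. (d i)\<^sup>2) \<le> V"
  shows "(\<integral>\<omega>. exp (s * (\<phi> (\<lambda>k. X k \<omega>) - (\<integral>\<omega>'. \<phi> (\<lambda>k. X k \<omega>') \<partial>M))) \<partial>M) \<le> exp (s\<^sup>2 * V / 2)"
proof -
  let ?f = "\<lambda>\<omega>. \<phi> (\<lambda>k. X k \<omega>)"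
  let ?C = "\<lambda>n. real_cond_exp M (past n) ?f"
  define \<mu> where "\<mu> = expectation ?f"
  have f[measurable]: "?f \<in> borel_measurable M" by measurable
  have fi: "integrable M ?f" using bd by (intro integrable_const_bound[where B = K]) auto
  have Ci: "integrable M (?C n)" for n
    by (rule sigma_finite_subalgebra.real_cond_exp_int(1)[OF sigma_finite_subalgebra_past fi])
  have eC: "integrable M (\<lambda>\<omega>. exp (s * ?C n \<omega>))" for n
    using s cond_exp_past_bounded[OF f bd] by (intro integrable_exp_bounded) auto
  have ef: "integrable M (\<lambda>\<omega>. exp (s * ?f \<omega>))"
    using s bd by (intro integrable_exp_bounded[where K = K]) auto
  have "AE \<omega> in M. ?C 0 \<omega> = \<mu>"
    using cond_exp_past[OF fi, of 0]
  proof eventually_elim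
    case (elim \<omega>)
    have c0: "cylinder 0 (\<lambda>k. X k \<omega>) = space M" by (simp add: cylinder_def)
    have "(\<integral>x. ?f x \<partial>given 0 (\<lambda>k. X k \<omega>)) = (\<integral>x. indicator (space M) x * ?f x \<partial>M)"
      unfolding c0 by (subst integral_uniform_measure) (auto simp: prob_space)
    also have "\<dots> = \<mu>" unfolding \<mu>_def by (intro Bochner_Integration.integral_cong) auto
    finally show ?case using elim by simp
  qed
  then have C0: "(\<integral>\<omega>. exp (s * ?C 0 \<omega>) \<partial>M) = exp (s * \<mu>)"
    by (subst integral_cong_AE[where g = "\<lambda>_. exp (s * \<mu>)"]) (auto simp: prob_space)
  have iter: "(\<integral>\<omega>. exp (s * ?C n \<omega>) \<partial>M) \<le> exp (s\<^sup>2 * (\<Sum>i<n. (d i)\<^sup>2) / 2) * exp (s * \<mu>)" for n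
  proof (induction n)
    case 0
    show ?case by (simp add: C0)
  next
    case (Suc n)
    have "(\<integral>\<omega>. exp (s * ?C (Suc n) \<omega>) \<partial>M) \<le> exp (s\<^sup>2 * (d n)\<^sup>2 / 2) * (\<integral>\<omega>. exp (s * ?C n \<omega>) \<partial>M)"
      by (rule mgf_cond_exp_step[OF f bd s osc d(1)])
    also have "\<dots> \<le> exp (s\<^sup>2 * (d n)\<^sup>2 / 2) * (exp (s\<^sup>2 * (\<Sum>i<n. (d i)\<^sup>2) / 2) * exp (s * \<mu>))"
      using Suc.IH by (rule mult_left_mono) simp
    also have "\<dots> = exp (s\<^sup>2 * (\<Sum>i<Suc n. (d i)\<^sup>2) / 2) * exp (s * \<mu>)"
      by (simp add: algebra_simps add_divide_distrib flip: exp_add)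
    finally show ?case .
  qed
  have "(\<integral>\<omega>. exp (s * ?f \<omega>) \<partial>M)
      \<le> exp (s\<^sup>2 * V / 2) * exp (s * \<mu>) + exp (s * K) * s * (\<integral>\<omega>. \<bar>?f \<omega> - ?C n \<omega>\<bar> \<partial>M)" for n
  proof -
    \<comment> \<open>The tangent inequality \<open>1 + y \<le> exp y\<close>, multiplied by
      \<open>exp (s * ?f \<omega>)\<close>, bounds the change of the exponential linearly by the L1
      error; only \<open>?f\<close> has to be bounded pointwise for this.\<close>
    have ptw: "exp (s * ?f \<omega>) \<le> exp (s * ?C n \<omega>) + exp (s * K) * s * \<bar>?f \<omega> - ?C n \<omega>\<bar>" for \<omega>
    proof -
      let ?y = "s * (?C n \<omega> - ?f \<omega>)"
      have "exp (s * ?f \<omega>) * (1 + ?y) \<le> exp (s * ?f \<omega>) * exp ?y"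
        by (intro mult_left_mono exp_ge_add_one_self) auto
      also have "\<dots> = exp (s * ?C n \<omega>)" by (simp add: algebra_simps flip: exp_add)
      finally have "exp (s * ?f \<omega>) \<le> exp (s * ?C n \<omega>) + exp (s * ?f \<omega>) * (- ?y)"
        by (simp add: algebra_simps)
      moreover have "exp (s * ?f \<omega>) * (- ?y) \<le> exp (s * K) * (s * \<bar>?f \<omega> - ?C n \<omega>\<bar>)"
      proof -
        have "?f \<omega> \<le> K" using bd[of "\<lambda>k. X k \<omega>"] by linarith
        then have "exp (s * ?f \<omega>) \<le> exp (s * K)" using s by simp
        moreover have "- ?y \<le> s * \<bar>?f \<omega> - ?C n \<omega>\<bar>"
          using s by (simp add: mult_left_mono flip: mult_minus_right)
        moreover have "0 \<le> s * \<bar>?f \<omega> - ?C n \<omega>\<bar>" using s by simp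
        ultimately show ?thesis
          by (meson exp_ge_zero mult_left_mono mult_right_mono order.trans)
      qed
      ultimately show ?thesis by (simp add: mult.assoc)
    qed
    have "(\<integral>\<omega>. exp (s * ?f \<omega>) \<partial>M) \<le> (\<integral>\<omega>. exp (s * ?C n \<omega>) + exp (s * K) * s * \<bar>?f \<omega> - ?C n \<omega>\<bar> \<partial>M)"
      using ef eC[of n] fi Ci[of n] ptw by (intro integral_mono) auto
    also have "\<dots> = (\<integral>\<omega>. exp (s * ?C n \<omega>) \<partial>M) + exp (s * K) * s * (\<integral>\<omega>. \<bar>?f \<omega> - ?C n \<omega>\<bar> \<partial>M)"
      using eC[of n] fi Ci[of n] by simp
    also have "(\<integral>\<omega>. exp (s * ?C n \<omega>) \<partial>M) \<le> exp (s\<^sup>2 * V / 2) * exp (s * \<mu>)"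
    proof (rule order.trans[OF iter])
      show "exp (s\<^sup>2 * (\<Sum>i<n. (d i)\<^sup>2) / 2) * exp (s * \<mu>) \<le> exp (s\<^sup>2 * V / 2) * exp (s * \<mu>)"
        using d(2)[of n] by (auto intro!: mult_right_mono mult_left_mono divide_right_mono)
    qed
    finally show ?thesis by simp
  qed
  moreover have "(\<lambda>n. exp (s\<^sup>2 * V / 2) * exp (s * \<mu>) + exp (s * K) * s * (\<integral>\<omega>. \<bar>?f \<omega> - ?C n \<omega>\<bar> \<partial>M))
      \<longlonglongrightarrow> exp (s\<^sup>2 * V / 2) * exp (s * \<mu>) + exp (s * K) * s * 0"
    by (intro tendsto_intros cond_exp_past_tendsto_L1 \<phi> fi)
  ultimately have "(\<integral>\<omega>. exp (s * ?f \<omega>) \<partial>M) \<le> exp (s\<^sup>2 * V / 2) * exp (s * \<mu>)"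
    by (intro LIMSEQ_le_const) auto
  then have "(\<integral>\<omega>. exp (s * ?f \<omega>) \<partial>M) * exp (- (s * \<mu>)) \<le> exp (s\<^sup>2 * V / 2) * exp (s * \<mu>) * exp (- (s * \<mu>))"
    by (intro mult_right_mono) auto
  also have "\<dots> = exp (s\<^sup>2 * V / 2)" by (simp flip: exp_add)
  also have "(\<integral>\<omega>. exp (s * ?f \<omega>) \<partial>M) * exp (- (s * \<mu>)) = (\<integral>\<omega>. exp (s * (?f \<omega> - \<mu>)) \<partial>M)"
    by (subst integral_mult_left_zero[symmetric]) (simp add: algebra_simps flip: exp_add)
  finally show ?thesis unfolding \<mu>_def .
qed

text \<open>The bound for a truncated function does not depend on the truncation level, so Fatou's
  lemma passes it on. The nonnegative integral is used because the integrability of the exponential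
  is not known beforehand.\<close>

lemma mgf_lipschitz:
  assumes fin: "matrix_norm (mixing_matrix M S X) < \<infinity>"
    and \<phi>[measurable]: "\<phi> \<in> borel_measurable (seq_space S)"
    and lip: "c_lipschitz S c \<phi>"
    and c: "\<And>i. 0 \<le> c i" "c \<in> ell2"
    and int: "integrable M (\<lambda>\<omega>. \<phi> (\<lambda>k. X k \<omega>))" and s: "0 < s"
  shows "(\<integral>\<^sup>+\<omega>. exp (s * (\<phi> (\<lambda>k. X k \<omega>) - (\<integral>\<omega>'. \<phi> (\<lambda>k. X k \<omega>') \<partial>M))) \<partial>M)
    \<le> exp (s\<^sup>2 * (ell2_norm (matrix_apply (mixing_matrix M S X) c))\<^sup>2 / 2)"
proof -
  let ?d = "matrix_apply (mixing_matrix M S X) c"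
  define V where "V = (ell2_norm ?d)\<^sup>2"
  have d2: "summable (\<lambda>i. (?d i)\<^sup>2)" using matrix_norm_finite(2)[OF fin c(2)] by (simp add: ell2_def)
  have d0: "0 \<le> ?d i" for i
    unfolding matrix_apply_def using matrix_norm_finite(1)[OF fin c(2)] c(1) eta_nonneg
    by (intro suminf_nonneg) (auto simp: mixing_matrix_def)
  have dV: "(\<Sum>i<n. (?d i)\<^sup>2) \<le> V" for n
    using sum_le_suminf[OF d2, of "{..<n}"] suminf_nonneg[OF d2] by (simp add: V_def ell2_norm_def)
  \<comment> \<open>Clipping to [-n, n] is 1-Lipschitz on the reals, so \<open>cl n\<close> inherits
    the constants \<open>c\<close>; the centres \<open>m n\<close> converge to \<open>\<mu>\<close>
    by dominated convergence.\<close>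
  define cl where "cl n y = max (- real n) (min (real n) (\<phi> y))" for n y
  define m where "m n = (\<integral>\<omega>. cl n (\<lambda>k. X k \<omega>) \<partial>M)" for n
  define \<mu> where "\<mu> = (\<integral>\<omega>. \<phi> (\<lambda>k. X k \<omega>) \<partial>M)"
  have cl_meas[measurable]: "cl n \<in> borel_measurable (seq_space S)" for n
    unfolding cl_def by measurable
  have cl_bd: "\<bar>cl n y\<bar> \<le> real n" for n y by (auto simp: cl_def)
  have cl_lip: "c_lipschitz S c (cl n)" for n
    unfolding c_lipschitz_def
  proof (intro allI ballI impI)
    fix i x x' assume "x \<in> UNIV \<rightarrow>\<^sub>E S" "x' \<in> UNIV \<rightarrow>\<^sub>E S" "differ_only_at i x x'"
    then have "\<bar>\<phi> x - \<phi> x'\<bar> \<le> c i" using lip by (auto simp: c_lipschitz_def)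
    then show "\<bar>cl n x - cl n x'\<bar> \<le> c i" by (auto simp: cl_def max_def min_def)
  qed
  have cl_lim: "(\<lambda>n. cl n y) \<longlonglongrightarrow> \<phi> y" for y
  proof (rule tendsto_eventually, rule eventually_sequentiallyI)
    fix n assume "nat \<lceil>\<bar>\<phi> y\<bar>\<rceil> \<le> n"
    then have "\<bar>\<phi> y\<bar> \<le> real n" by linarith
    then show "cl n y = \<phi> y" by (auto simp: cl_def max_def min_def)
  qed
  have m_lim: "m \<longlonglongrightarrow> \<mu>"
    unfolding m_def \<mu>_def
    by (rule integral_dominated_convergence[where w = "\<lambda>\<omega>. \<bar>\<phi> (\<lambda>k. X k \<omega>)\<bar>"])
      (use int cl_lim in \<open>auto simp: cl_def\<close>)
  have bound: "(\<integral>\<^sup>+\<omega>. exp (s * (cl n (\<lambda>k. X k \<omega>) - m n)) \<partial>M) \<le> exp (s\<^sup>2 * V / 2)" for n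
  proof -
    have "AE \<omega> in M. \<bar>cl n (\<lambda>k. X k \<omega>) - m n\<bar> \<le> real n + \<bar>m n\<bar>"
      using cl_bd[of n] by (intro AE_I2) (smt (verit))
    then have "integrable M (\<lambda>\<omega>. exp (s * (cl n (\<lambda>k. X k \<omega>) - m n)))"
      using s by (intro integrable_exp_bounded) auto
    moreover have "(\<integral>\<omega>. exp (s * (cl n (\<lambda>k. X k \<omega>) - m n)) \<partial>M) \<le> exp (s\<^sup>2 * V / 2)"
      unfolding m_def
      by (rule mgf_bounded[OF cl_meas cl_bd s _ d0 dV])
        (rule integral_diff_le_matrix_apply[OF fin cl_meas cl_bd cl_lip c])
    ultimately show ?thesis by (subst nn_integral_eq_integral) auto
  qed
  have "(\<integral>\<^sup>+\<omega>. exp (s * (\<phi> (\<lambda>k. X k \<omega>) - \<mu>)) \<partial>M)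
      = (\<integral>\<^sup>+\<omega>. liminf (\<lambda>n. ennreal (exp (s * (cl n (\<lambda>k. X k \<omega>) - m n)))) \<partial>M)"
  proof (rule nn_integral_cong)
    fix \<omega>
    have "(\<lambda>n. ennreal (exp (s * (cl n (\<lambda>k. X k \<omega>) - m n)))) \<longlonglongrightarrow> ennreal (exp (s * (\<phi> (\<lambda>k. X k \<omega>) - \<mu>)))"
      by (intro tendsto_ennrealI tendsto_intros cl_lim m_lim)
    then show "ennreal (exp (s * (\<phi> (\<lambda>k. X k \<omega>) - \<mu>))) = liminf (\<lambda>n. ennreal (exp (s * (cl n (\<lambda>k. X k \<omega>) - m n))))"
      by (intro lim_imp_Liminf[symmetric]) auto
  qed
  also have "\<dots> \<le> liminf (\<lambda>n. \<integral>\<^sup>+\<omega>. exp (s * (cl n (\<lambda>k. X k \<omega>) - m n)) \<partial>M)"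
    by (rule nn_integral_liminf) measurable
  also have "\<dots> \<le> exp (s\<^sup>2 * V / 2)"
    using bound by (intro Liminf_le always_eventually) auto
  finally show ?thesis unfolding \<mu>_def V_def .
qed

section \<open>Tail bounds\<close>

text \<open>Chernoff's inequality. The parameter \<open>s\<close> stays free: it is optimised only
  after the norm of the image vector has been estimated, and it is sent to infinity when that
  estimate is 0.\<close>

lemma upper_tail_lipschitz:
  assumes "matrix_norm (mixing_matrix M S X) < \<infinity>"
    and [measurable]: "\<phi> \<in> borel_measurable (seq_space S)"
    and "c_lipschitz S c \<phi>" "\<And>i. 0 \<le> c i" "c \<in> ell2"
    and "integrable M (\<lambda>\<omega>. \<phi> (\<lambda>k. X k \<omega>))" and s: "0 < s"
  shows "\<P>(\<omega> in M. t \<le> \<phi> (\<lambda>k. X k \<omega>) - (\<integral>\<omega>'. \<phi> (\<lambda>k. X k \<omega>') \<partial>M))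
    \<le> exp (s\<^sup>2 * (ell2_norm (matrix_apply (mixing_matrix M S X) c))\<^sup>2 / 2 - s * t)"
proof -
  let ?Z = "\<lambda>\<omega>. \<phi> (\<lambda>k. X k \<omega>) - (\<integral>\<omega>'. \<phi> (\<lambda>k. X k \<omega>') \<partial>M)"
  let ?b = "s\<^sup>2 * (ell2_norm (matrix_apply (mixing_matrix M S X) c))\<^sup>2 / 2"
  have "emeasure M {\<omega> \<in> space M. t \<le> ?Z \<omega>}
      \<le> ennreal (exp (- s * t)) * (\<integral>\<^sup>+\<omega>. ennreal (exp (s * ?Z \<omega>)) * indicator (space M) \<omega> \<partial>M)"
    by (rule Chernoff_ineq_nn_integral_ge[OF s]) auto
  also have "(\<integral>\<^sup>+\<omega>. ennreal (exp (s * ?Z \<omega>)) * indicator (space M) \<omega> \<partial>M) = (\<integral>\<^sup>+\<omega>. exp (s * ?Z \<omega>) \<partial>M)"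
    by (intro nn_integral_cong) auto
  also have "ennreal (exp (- s * t)) * \<dots> \<le> ennreal (exp (- s * t)) * exp ?b"
    by (intro mult_left_mono mgf_lipschitz assms) auto
  also have "\<dots> = ennreal (exp (?b - s * t))" by (simp flip: ennreal_mult exp_add)
  finally show ?thesis by (simp add: emeasure_eq_measure)
qed

text \<open>The lower tail of \<open>\<phi>\<close> is the upper tail of \<open>- \<phi>\<close>,
  which has the same Lipschitz constants; this gives the factor 2.\<close>

lemma tail_lipschitz:
  assumes fin: "matrix_norm (mixing_matrix M S X) < \<infinity>"
    and \<phi>[measurable]: "\<phi> \<in> borel_measurable (seq_space S)"
    and lip: "c_lipschitz S c \<phi>" and c: "\<And>i. 0 \<le> c i" "c \<in> ell2"
    and int: "integrable M (\<lambda>\<omega>. \<phi> (\<lambda>k. X k \<omega>))" and s: "0 < s"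
  shows "\<P>(\<omega> in M. t \<le> \<bar>\<phi> (\<lambda>k. X k \<omega>) - (\<integral>\<omega>'. \<phi> (\<lambda>k. X k \<omega>') \<partial>M)\<bar>)
    \<le> 2 * exp (s\<^sup>2 * (ell2_norm (matrix_apply (mixing_matrix M S X) c))\<^sup>2 / 2 - s * t)"
proof -
  let ?Z = "\<lambda>\<omega>. \<phi> (\<lambda>k. X k \<omega>) - (\<integral>\<omega>'. \<phi> (\<lambda>k. X k \<omega>') \<partial>M)"
  let ?e = "exp (s\<^sup>2 * (ell2_norm (matrix_apply (mixing_matrix M S X) c))\<^sup>2 / 2 - s * t)"
  have "{\<omega> \<in> space M. t \<le> \<bar>?Z \<omega>\<bar>} = {\<omega> \<in> space M. t \<le> ?Z \<omega>} \<union> {\<omega> \<in> space M. t \<le> - ?Z \<omega>}"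
    by auto
  then have "\<P>(\<omega> in M. t \<le> \<bar>?Z \<omega>\<bar>) \<le> \<P>(\<omega> in M. t \<le> ?Z \<omega>) + \<P>(\<omega> in M. t \<le> - ?Z \<omega>)"
    by (simp only:) (rule measure_Un_le; measurable)
  also have "\<P>(\<omega> in M. t \<le> ?Z \<omega>) \<le> ?e"
    by (rule upper_tail_lipschitz[OF fin \<phi> lip c int s])
  also have "\<P>(\<omega> in M. t \<le> - ?Z \<omega>) \<le> ?e"
  proof -
    have "c_lipschitz S c (\<lambda>y. - \<phi> y)" using lip by (simp add: c_lipschitz_def abs_minus_commute)
    from upper_tail_lipschitz[OF fin _ this c _ s, of t] show ?thesis using int by simp
  qed
  finally show ?thesis by simp
qed

end

text \<open>For \<open>ell2_norm c = 0\<close> the exponent has to be read as minus infinity,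
  whereas HOL division by zero would make it 0 and the bound trivial. The separate value 0 expresses
  the strong reading, a zero-one law: \<open>\<phi>\<close> of the process is almost surely
  constant.\<close>

theorem proposition6:
  fixes M :: "'a measure" and S :: "'b set" and X :: "nat \<Rightarrow> 'a \<Rightarrow> 'b"
    and \<phi> :: "(nat \<Rightarrow> 'b) \<Rightarrow> real" and c :: "nat \<Rightarrow> real" and t :: real
  assumes "prob_space M"
    and "countable S"
    and "\<And>i. X i \<in> measurable M (count_space S)"
    and "matrix_norm (mixing_matrix M S X) < \<infinity>"
    and "\<phi> \<in> borel_measurable (seq_space S)"
    and "c \<in> ell2"
    and "c_lipschitz S c \<phi>"
    and "integrable M (\<lambda>\<omega>. \<phi> (\<lambda>i. X i \<omega>))"
    and "t > 0"
  shows "\<P>(\<omega> in M. \<bar>\<phi> (\<lambda>i. X i \<omega>) - (\<integral>\<omega>'. \<phi> (\<lambda>i. X i \<omega>') \<partial>M)\<bar> \<ge> t)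
    \<le> (if ell2_norm c = 0 then 0
       else 2 * exp (- t\<^sup>2 / (2 * (real_of_ereal (matrix_norm (mixing_matrix M S X)))\<^sup>2 * (ell2_norm c)\<^sup>2)))"
proof -
  interpret prob_space M by fact
  interpret discrete_process M S X by standard (fact assms)+
  let ?P = "\<P>(\<omega> in M. \<bar>\<phi> (\<lambda>i. X i \<omega>) - (\<integral>\<omega>'. \<phi> (\<lambda>i. X i \<omega>') \<partial>M)\<bar> \<ge> t)"
  let ?D = "mixing_matrix M S X"
  \<comment> \<open>If \<open>S\<close> has at most one element, the Lipschitz condition is vacuous
    and entries of \<open>c\<close> may be negative. Absolute values restore nonnegativity without
    changing the norm.\<close>
  define c' where "c' i = \<bar>c i\<bar>" for i
  have norm_c': "ell2_norm c' = ell2_norm c" by (simp add: ell2_norm_def c'_def)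
  have c': "\<And>i. 0 \<le> c' i" "c' \<in> ell2" using assms(6) by (auto simp: c'_def ell2_def)
  have lip: "c_lipschitz S c' \<phi>"
    using assms(7) unfolding c_lipschitz_def c'_def by (meson abs_ge_self order.trans)
  define B where "B = real_of_ereal (matrix_norm ?D) * ell2_norm c"
  have dB: "ell2_norm (matrix_apply ?D c') \<le> B"
    using matrix_norm_finite(3)[OF assms(4) c'(2)] by (simp add: B_def norm_c')
  have norm_nonneg: "0 \<le> ell2_norm v" if "v \<in> ell2" for v
    using that suminf_nonneg[of "\<lambda>j. (v j)\<^sup>2"] by (simp add: ell2_def ell2_norm_def)
  have d0: "0 \<le> ell2_norm (matrix_apply ?D c')"
    using norm_nonneg matrix_norm_finite(2)[OF assms(4) c'(2)] by blast
  have tail: "?P \<le> 2 * exp (s\<^sup>2 * B\<^sup>2 / 2 - s * t)" if "0 < s" for s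
  proof -
    have "?P \<le> 2 * exp (s\<^sup>2 * (ell2_norm (matrix_apply ?D c'))\<^sup>2 / 2 - s * t)"
      by (rule tail_lipschitz[OF assms(4,5) lip c' assms(8) that])
    also have "\<dots> \<le> 2 * exp (s\<^sup>2 * B\<^sup>2 / 2 - s * t)"
      using power_mono[OF dB d0, of 2] by (simp add: mult_left_mono)
    finally show ?thesis .
  qed
  show ?thesis
  proof (cases "ell2_norm c = 0")
    case True
    \<comment> \<open>Here \<open>B = 0\<close>, so the quadratic term vanishes and
      \<open>s = real n\<close> may tend to infinity. At \<open>n = 0\<close>, where
      \<open>s\<close> would not be positive, the bound is 2.\<close>
    then have "?P \<le> 2 * exp (- (real n * t))" for n
      using tail[of "real n"] by (cases "n = 0") (auto simp: B_def intro: order.trans[OF prob_le_1])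
    moreover have "(\<lambda>n. 2 * exp (- (real n * t))) \<longlonglongrightarrow> 0"
      using assms(9) by real_asymp
    ultimately have "?P \<le> 0" by (intro LIMSEQ_le_const[of _ 0]) blast+
    then show ?thesis using True by simp
  next
    case False
    have "?P \<le> 2 * exp (- t\<^sup>2 / (2 * B\<^sup>2))"
    \<comment> \<open>With \<open>B = 0\<close> the quotient is 0 in HOL, and the claimed bound is
      2.\<close>
    proof (cases "B = 0")
      case True
      then show ?thesis by (auto intro: order.trans[OF prob_le_1])
    next
      case False
      then have "B\<^sup>2 > 0" by simp
      \<comment> \<open>\<open>s = t / B\<^sup>2\<close> minimises the quadratic
        \<open>s\<^sup>2 * B\<^sup>2 / 2 - s * t\<close>.\<close>
      then have "(t / B\<^sup>2)\<^sup>2 * B\<^sup>2 / 2 - t / B\<^sup>2 * t = - t\<^sup>2 / (2 * B\<^sup>2)"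
        by (simp add: field_simps power2_eq_square)
      then show ?thesis using tail[of "t / B\<^sup>2"] \<open>B\<^sup>2 > 0\<close> assms(9) by simp
    qed
    then show ?thesis using False by (simp add: B_def power_mult_distrib mult.assoc)
  qed
qed

end
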